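(* The full Martin boundary and the minimal Martin boundary of the path-forest graph $\Gamma_{\mathrm{pf}}$ coincide and are homeomorphic to $\nabla_\infty$, the point $p\in\nabla_\infty$ corresponding to the boundary point with coordinates $$K^{\mathrm{pf}}_\mu(p)=u(P_\mu)\,\chi_p(\widetilde m_\mu)\qquad(\mu\in\mathbb Y).$$ For any sequence of integers $N_j\to\infty$ and partitions $\lambda^{(j)}\vdash N_j$, convergence of $\lambda^{(j)}$ to the boundary point $p$ in the Martin compactification is equivalent to $\lambda^{(j)}_i/N_j\to p_i$ for every fixed $i\ge1$.
   Context: Rooted trees are finite, unlabelled and non-plane. For an integer partition $\lambda$, $P_\lambda$ is the rooted tree whose root branches (components after deleting the root) are chains (paths rooted at an end) with $\lambda_1,\lambda_2,\dots$ vertices; these are the path-forest trees (every non-root vertex has at most one child). $\mathbb Y$ is the set of all integer partitions; $\lambda\vdash N$ means $|\lambda|=\sum_i\lambda_i=N$; parts are listed in nonincreasing order with zero padding. For trees $s,t$, $n(s;t)$ is the number of vertices $v$ of $s$ such that attaching a new leaf at $v$ yields $t$. $\Gamma_{\mathrm{pf}}$ is the graded graph with vertices $P_\lambda$, $\lambda\in\mathbb Y$ (level $|\lambda|$), and $n(P_\mu;P_\lambda)$ edge copies from $P_\mu$ to $P_\lambda$. $n_{\mathrm{pf}}(\mu;\lambda)$ is the number of paths of edge copies from $P_\mu$ to $P_\lambda$ (zero if $|\mu|>|\lambda|$, and $\delta_{\mu\lambda}$ if $|\mu|=|\lambda|$), and $u(P_\lambda)=n_{\mathrm{pf}}(\varnothing;\lambda)$.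 The Martin kernel is $$K^{\mathrm{pf}}_\mu(\lambda)=\frac{u(P_\mu)\,n_{\mathrm{pf}}(\mu;\lambda)}{u(P_\lambda)}\in[0,1].$$ The Martin compactification $\Omega_M(\Gamma_{\mathrm{pf}})$ is the closure in $[0,1]^{\mathbb Y}$ (product topology) of the image of the embedding $\lambda\mapsto(K^{\mathrm{pf}}_\mu(\lambda))_{\mu\in\mathbb Y}$; $K^{\mathrm{pf}}_\mu$ also denotes the coordinate function on it. The (full) Martin boundary is this closure minus the embedded finite vertices $\lambda\in\mathbb Y$. For a boundary point $z$ put $h_z(P_\mu)=K^{\mathrm{pf}}_\mu(z)/u(P_\mu)$. A function $h\ge 0$ on the vertices of $\Gamma_{\mathrm{pf}}$ is harmonic if $h(P_\mu)=\sum_\lambda n(P_\mu;P_\lambda)h(P_\lambda)$ (sum over $\lambda$ with $|\lambda|=|\mu|+1$), and normalized if $h(P_\varnothing)=1$; a nonzero nonnegative harmonic $h$ spans a minimal ray if every harmonic $g$ with $0\le g\le h$ is a scalar multiple of $h$. The minimal Martin boundary consists of the boundary points $z$ for which $h_z$ is normalized nonnegative harmonic and spans a minimal ray. $\nabla_\infty=\{p_1\ge p_2\ge\cdots\ge0:\sum_ip_i\le1\}$ with the product topology. $\Lambda=\mathbb R[\mathsf p_1,\mathsf p_2,\dots]$ is the algebra of symmetric functions ($\mathsf p_k$ the power sums), $m_\mu$ the monomial symmetric function, $\widetilde m_\mu=\big(\prod_{j\ge1}r_j(\mu)!\big)m_\mu$ with $r_j(\mu)$ the multiplicity of the part $j$;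 $\chi_p:\Lambda\to\mathbb R$ is the unital algebra homomorphism with $\chi_p(\mathsf p_1)=1$ and $\chi_p(\mathsf p_k)=\sum_ip_i^k$ for $k\ge2$. *)

theory Defs
  imports "HOL-Analysis.Analysis" "HOL-Library.Multiset" "HOL-Library.Poly_Mapping"
begin

section \<open>Rooted trees and integer partitions\<close>

text \<open>An unlabelled non-plane rooted tree is the multiset of its root branches.\<close>

datatype rtree = Node "rtree multiset"

abbreviation single_vertex :: rtree where
  "single_vertex \<equiv> Node {#}"

text \<open>
  One entry for each vertex \<open>v\<close> of the tree, namely the tree obtained by attaching a new leaf
  at \<open>v\<close>: either \<open>v\<close> is the root, or \<open>v\<close> lies in one of the branches \<open>b\<close> (counted with
  multiplicity), and then \<open>b\<close> is replaced by the enlarged branch. Hence \<open>n(s;t)\<close> is the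
  multiplicity of \<open>t\<close> among the entries for \<open>s\<close>.
\<close>

primrec leaf_attachments :: "rtree \<Rightarrow> rtree multiset" where
  "leaf_attachments (Node B) =
     add_mset (Node (add_mset single_vertex B))
       (\<Sum>(b, A) \<in># image_mset (\<lambda>b. (b, leaf_attachments b)) B.
          image_mset (\<lambda>b'. Node (add_mset b' (B - {#b#}))) A)"

definition n_attach :: "rtree \<Rightarrow> rtree \<Rightarrow> nat" where
  "n_attach s t = count (leaf_attachments s) t"

typedef int_partition = "{M :: nat multiset. 0 \<notin># M}"
  morphisms parts Partition
  by (rule exI[of _ "{#}"]) simp

definition empty_partition :: int_partition where
  "empty_partition = Partition {#}"

definition psize :: "int_partition \<Rightarrow> nat" where
  "psize \<rho> = \<Sum>\<^sub># (parts \<rho>)"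

text \<open>Indices start at \<open>0\<close>: \<open>nth_part \<rho> i\<close> is the part usually written \<open>\<rho>\<^sub>i\<^sub>+\<^sub>1\<close>.\<close>

definition nth_part :: "int_partition \<Rightarrow> nat \<Rightarrow> nat" where
  "nth_part \<rho> i = (let xs = rev (sorted_list_of_multiset (parts \<rho>))
               in if i < length xs then xs ! i else 0)"

text \<open>\<open>chain k\<close> is the path with \<open>k\<close> vertices rooted at an end, for \<open>k \<ge> 1\<close>.\<close>

definition chain :: "nat \<Rightarrow> rtree" where
  "chain k = ((\<lambda>t. Node {#t#}) ^^ (k - 1)) single_vertex"

definition pf_tree :: "int_partition \<Rightarrow> rtree" where
  "pf_tree \<rho> = Node (image_mset chain (parts \<rho>))"


section \<open>The path-forest graph\<close>

text \<open>
  Vertices \<open>P\<^sub>\<rho>\<close> are represented by their index \<open>\<rho>\<close>. An edge copy is a triple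
  \<open>(\<nu>, i, \<kappa>)\<close>, where \<open>i < n(P\<^sub>\<nu>; P\<^sub>\<kappa>)\<close> distinguishes the copies.
\<close>

fun pf_path :: "int_partition \<Rightarrow> (int_partition \<times> nat \<times> int_partition) list
    \<Rightarrow> int_partition \<Rightarrow> bool" where
  "pf_path \<mu> [] \<rho> \<longleftrightarrow> \<mu> = \<rho>"
| "pf_path \<mu> ((\<nu>, i, \<kappa>) # es) \<rho> \<longleftrightarrow>
     \<nu> = \<mu> \<and> i < n_attach (pf_tree \<nu>) (pf_tree \<kappa>) \<and> pf_path \<kappa> es \<rho>"

definition n_pf :: "int_partition \<Rightarrow> int_partition \<Rightarrow> nat" where
  "n_pf \<mu> \<rho> = card {es. pf_path \<mu> es \<rho>}"

definition u_pf :: "int_partition \<Rightarrow> nat" where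
  "u_pf \<rho> = n_pf empty_partition \<rho>"

text \<open>Functions on the vertices of the graph are functions of the index.\<close>

definition harmonic :: "(int_partition \<Rightarrow> real) \<Rightarrow> bool" where
  "harmonic h \<longleftrightarrow> (\<forall>\<mu>. h \<mu> \<ge> 0) \<and>
     (\<forall>\<mu>. h \<mu> = (\<Sum>\<rho> | psize \<rho> = psize \<mu> + 1.
                     real (n_attach (pf_tree \<mu>) (pf_tree \<rho>)) * h \<rho>))"

definition normalized :: "(int_partition \<Rightarrow> real) \<Rightarrow> bool" where
  "normalized h \<longleftrightarrow> h empty_partition = 1"

definition spans_minimal_ray :: "(int_partition \<Rightarrow> real) \<Rightarrow> bool" where
  "spans_minimal_ray h \<longleftrightarrow> harmonic h \<and> (\<exists>\<mu>. h \<mu> \<noteq> 0) \<and>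
     (\<forall>g. harmonic g \<and> (\<forall>\<mu>. g \<mu> \<le> h \<mu>) \<longrightarrow> (\<exists>c. \<forall>\<mu>. g \<mu> = c * h \<mu>))"


section \<open>Martin compactification and boundaries\<close>

definition martin_kernel :: "int_partition \<Rightarrow> int_partition \<Rightarrow> real" where
  "martin_kernel \<mu> \<rho> = real (u_pf \<mu>) * real (n_pf \<mu> \<rho>) / real (u_pf \<rho>)"

definition martin_embed :: "int_partition \<Rightarrow> (int_partition \<Rightarrow> real)" where
  "martin_embed \<rho> = (\<lambda>\<mu>. martin_kernel \<mu> \<rho>)"

text \<open>
  The function type carries the product topology. The kernel takes values in \<open>[0,1]\<close>, and
  the cube is closed in the space of all real functions, so the closure may be taken there.
\<close>

definition martin_compactification :: "(int_partition \<Rightarrow> real) set" where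
  "martin_compactification = closure (range martin_embed)"

definition martin_boundary :: "(int_partition \<Rightarrow> real) set" where
  "martin_boundary = martin_compactification - range martin_embed"

definition boundary_fun :: "(int_partition \<Rightarrow> real) \<Rightarrow> (int_partition \<Rightarrow> real)" where
  "boundary_fun z = (\<lambda>\<mu>. z \<mu> / real (u_pf \<mu>))"

definition minimal_martin_boundary :: "(int_partition \<Rightarrow> real) set" where
  "minimal_martin_boundary =
     {z \<in> martin_boundary. normalized (boundary_fun z) \<and> harmonic (boundary_fun z) \<and>
        spans_minimal_ray (boundary_fun z)}"

text \<open>The coordinate \<open>p i\<close> is the one usually written \<open>p\<^sub>i\<^sub>+\<^sub>1\<close>.\<close>

definition nabla_infty :: "(nat \<Rightarrow> real) set" where
  "nabla_infty = {p. decseq p \<and> (\<forall>i. p i \<ge> 0) \<and> summable p \<and> suminf p \<le> 1}"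


section \<open>Symmetric functions\<close>

text \<open>
  Symmetric functions are symmetric formal series of bounded degree in \<open>x\<^sub>0, x\<^sub>1, \<dots>\<close>. A
  monomial is its finitely supported exponent vector, and a series is its coefficient function.
\<close>

type_synonym monomial = "nat \<Rightarrow>\<^sub>0 nat"
type_synonym series = "monomial \<Rightarrow> real"

definition mdegree :: "monomial \<Rightarrow> nat" where
  "mdegree \<alpha> = (\<Sum>i\<in>Poly_Mapping.keys \<alpha>. Poly_Mapping.lookup \<alpha> i)"

definition symmetric_functions :: "series set" where
  "symmetric_functions =
     {f. (\<exists>d. \<forall>\<alpha>. f \<alpha> \<noteq> 0 \<longrightarrow> mdegree \<alpha> \<le> d) \<and>
         (\<forall>\<pi> \<alpha>. bij \<pi> \<longrightarrow> f (Poly_Mapping.map_key \<pi> \<alpha>) = f \<alpha>)}"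

definition series_add :: "series \<Rightarrow> series \<Rightarrow> series" where
  "series_add f g = (\<lambda>\<alpha>. f \<alpha> + g \<alpha>)"

definition series_scale :: "real \<Rightarrow> series \<Rightarrow> series" where
  "series_scale c f = (\<lambda>\<alpha>. c * f \<alpha>)"

definition series_mult :: "series \<Rightarrow> series \<Rightarrow> series" where
  "series_mult f g = (\<lambda>\<alpha>. \<Sum>(\<beta>, \<gamma>) | \<beta> + \<gamma> = \<alpha>. f \<beta> * g \<gamma>)"

definition series_one :: series where
  "series_one = (\<lambda>\<alpha>. if \<alpha> = 0 then 1 else 0)"

definition power_sum :: "nat \<Rightarrow> series" where
  "power_sum k = (\<lambda>\<alpha>. if \<exists>i. \<alpha> = Poly_Mapping.single i k then 1 else 0)"

definition monomial_sym :: "int_partition \<Rightarrow> series" where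
  "monomial_sym \<mu> = (\<lambda>\<alpha>.
     if image_mset (Poly_Mapping.lookup \<alpha>) (mset_set (Poly_Mapping.keys \<alpha>)) = parts \<mu>
     then 1 else 0)"

definition aug_monomial_sym :: "int_partition \<Rightarrow> series" where
  "aug_monomial_sym \<mu> =
     series_scale (\<Prod>j\<in>set_mset (parts \<mu>). fact (count (parts \<mu>) j)) (monomial_sym \<mu>)"

definition symfun_alg_hom :: "(series \<Rightarrow> real) \<Rightarrow> bool" where
  "symfun_alg_hom \<phi> \<longleftrightarrow> \<phi> series_one = 1 \<and>
     (\<forall>f\<in>symmetric_functions. \<forall>g\<in>symmetric_functions.
        \<phi> (series_add f g) = \<phi> f + \<phi> g \<and> \<phi> (series_mult f g) = \<phi> f * \<phi> g) \<and>
     (\<forall>c. \<forall>f\<in>symmetric_functions. \<phi> (series_scale c f) = c * \<phi> f)"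

text \<open>
  The power sums generate the algebra of symmetric functions freely over the reals, so the
  conditions below can be met and determine \<open>chi p\<close> on all symmetric functions. The values
  of \<open>chi p\<close> on other series are irrelevant.
\<close>

definition chi :: "(nat \<Rightarrow> real) \<Rightarrow> series \<Rightarrow> real" where
  "chi p = (SOME \<phi>. symfun_alg_hom \<phi> \<and> \<phi> (power_sum 1) = 1 \<and>
              (\<forall>k\<ge>2. \<phi> (power_sum k) = suminf (\<lambda>i. p i ^ k)))"

definition boundary_point :: "(nat \<Rightarrow> real) \<Rightarrow> (int_partition \<Rightarrow> real)" where
  "boundary_point p = (\<lambda>\<mu>. real (u_pf \<mu>) * chi p (aug_monomial_sym \<mu>))"

end

theory Submission
  imports Defs
begin

text \<open>
  The path-forest graph is Kingman's graph in another gauge: paths from the empty partition to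
  \<open>\<rho>\<close> are set partitions of shape \<open>\<rho>\<close>. Hence \<open>n(\<mu>;\<rho>) / u(\<rho>)\<close> is a sum over injections of the
  parts of \<open>\<mu>\<close> into those of \<open>\<rho>\<close> of products of falling factorials, divided by a falling factorial
  of \<open>N = |\<rho>|\<close>, and differs by \<open>O(1/N)\<close> from the augmented monomial of \<open>\<mu>\<close> evaluated at \<open>\<rho>/N\<close>,
  a point of \<open>\<nabla>\<^sub>\<infinity>\<close>. An augmented monomial is a polynomial in the power sums, those of
  degree at least 2 are continuous on the compact space \<open>\<nabla>\<^sub>\<infinity>\<close> and separate its points, and this
  gives the homeomorphism and the criterion for convergence.

  For minimality, let \<open>h\<close> belong to \<open>p\<close>. Under the law of weight \<open>u(\<rho>) h(\<rho>)\<close> on the partitions of \<open>N\<close>,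
  each power sum of \<open>\<rho>/N\<close> has mean and second moment converging to those of a constant, because
  \<open>\<chi>\<^sub>p\<close> is multiplicative. So \<open>n(\<mu>;\<rho>) / u(\<rho>)\<close> converges to \<open>h(\<mu>)\<close> in mean, which forces
  \<open>g = g(\<emptyset>) h\<close> for harmonic \<open>g \<le> h\<close>.
\<close>

section \<open>Sums over injections\<close>

text \<open>A single product rule, \<open>inj_sum_mult\<close>, serves both sides of the comparison:
  for powers it multiplies an augmented monomial by a power sum, for falling factorials it is the
  growth rule of the graph. Estimating the kernel thus means comparing two weights in the same sum.
  The obstacle is the first power sum. A limit of points of mass 1 may lose mass to infinitely many
  vanishing coordinates, so the sum of the coordinates is not continuous on the simplex, and at a
  point of smaller mass an augmented monomial is not a sum over injections. Its values are therefore
  carried by polynomials in formal power sums, the first of which is fixed at 1. This makes them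
  continuous, and also harmonic, because one step in the graph is multiplication by the first power
  sum. The signs in these polynomials hide that the values lie in [0, 1] and do not depend on the
  order of the parts; the bounds are obtained as limits along partitions, the symmetry from
  \<open>chi p\<close>.\<close>

fun inj_sum :: "(nat \<Rightarrow> 'i \<Rightarrow> 'b::comm_ring_1) \<Rightarrow> nat list \<Rightarrow> 'i set \<Rightarrow> 'b" where
  "inj_sum w [] I = 1"
| "inj_sum w (a # xs) I = (\<Sum>i\<in>I. w a i * inj_sum w xs (I - {i}))"

text \<open>Both sides sum over ordered pairs of distinct indices. Filling the diagonal with zeros
  frees the inner range from the outer index, so the sums can be exchanged.\<close>

lemma inj_sum_swap:
  assumes "finite I"
  shows "inj_sum w (a # b # xs) I = inj_sum w (b # a # xs) I"
proof -
  have E: "inj_sum w (a # b # xs) I =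
      (\<Sum>i\<in>I. \<Sum>j\<in>I. if i = j then 0 else w a i * w b j * inj_sum w xs (I - {i} - {j}))" for a b
  proof -
    have "inj_sum w (a # b # xs) I = (\<Sum>i\<in>I. \<Sum>j\<in>I-{i}. w a i * w b j * inj_sum w xs (I - {i} - {j}))"
      by (simp add: sum_distrib_left mult.assoc)
    also have "\<dots> = (\<Sum>i\<in>I. \<Sum>j\<in>I. if i = j then 0 else w a i * w b j * inj_sum w xs (I - {i} - {j}))"
      using assms by (intro sum.cong refl sum.mono_neutral_cong_left) auto
    finally show ?thesis .
  qed
  have "inj_sum w (a # b # xs) I =
      (\<Sum>j\<in>I. \<Sum>i\<in>I. if i = j then 0 else w a i * w b j * inj_sum w xs (I - {i} - {j}))"
    unfolding E by (rule sum.swap)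
  also have "\<dots> = inj_sum w (b # a # xs) I"
    unfolding E by (intro sum.cong refl) (auto simp: Diff_insert2[symmetric] insert_commute mult_ac)
  finally show ?thesis .
qed

lemma inj_sum_remove1:
  "finite I \<Longrightarrow> a \<in> set ys \<Longrightarrow> inj_sum w ys I = inj_sum w (a # remove1 a ys) I"
proof (induction ys arbitrary: I)
  case (Cons b ys)
  show ?case
  proof (cases "a = b")
    case False
    have "inj_sum w (b # ys) I = (\<Sum>i\<in>I. w b i * inj_sum w (a # remove1 a ys) (I - {i}))"
      using Cons.IH[of "I - {_}"] Cons.prems False by simp
    also have "\<dots> = inj_sum w (b # a # remove1 a ys) I" by simp
    also have "\<dots> = inj_sum w (a # b # remove1 a ys) I" by (rule inj_sum_swap[OF Cons.prems(1)])
    finally show ?thesis using False by simp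
  qed simp
qed simp

text \<open>Makes the sum a function of a partition; swaps bring the head of one list to the front
  of the other.\<close>

lemma inj_sum_mset_cong:
  "finite I \<Longrightarrow> mset xs = mset ys \<Longrightarrow> inj_sum w xs I = inj_sum w ys I"
proof (induction xs arbitrary: ys I)
  case (Cons a xs)
  then have a: "a \<in> set ys" by (metis list.set_intros(1) set_mset_mset)
  have "mset xs = mset (remove1 a ys)" using Cons.prems(2)
    by (metis add_mset_remove_trivial mset.simps(2) mset_remove1)
  with Cons show ?case by (simp add: inj_sum_remove1[OF _ a] del: mset_remove1)
qed simp

lemma sum_list_update_Cons:
  fixes f :: "nat list \<Rightarrow> 'b::comm_monoid_add"
  shows "(\<Sum>j<length (b # xs). f ((b # xs)[j := (b # xs) ! j + a])) =
         f ((b + a) # xs) + (\<Sum>j<length xs. f (b # xs[j := xs ! j + a]))"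
  by (simp add: sum.lessThan_Suc_shift del: sum.lessThan_Suc)

text \<open>The additional index either avoids the images of all entries, which lengthens the list,
  or meets the image of an entry \<open>b\<close>, where the two weights merge at the price of
  \<open>t b\<close>. Powers satisfy the hypothesis with \<open>t = 0\<close>, falling factorials
  with \<open>a = 1\<close> and \<open>t b = b\<close>.\<close>

lemma inj_sum_mult:
  assumes "finite I" and w: "\<And>b i. w b i * (w a i - t b) = w (b + a) i"
  shows "((\<Sum>i\<in>I. w a i) - (\<Sum>b\<leftarrow>xs. t b)) * inj_sum w xs I =
         inj_sum w (a # xs) I + (\<Sum>j<length xs. inj_sum w (xs[j := xs ! j + a]) I)"
  using assms(1)
proof (induction xs arbitrary: I)
  case (Cons b ys)
  let ?s = "\<lambda>I. \<Sum>i\<in>I. w a i" and ?T = "\<Sum>b\<leftarrow>ys. t b"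
  have "(?s I - (\<Sum>b\<leftarrow>b # ys. t b)) * inj_sum w (b # ys) I =
      (\<Sum>i\<in>I. (?s I - (\<Sum>b\<leftarrow>b # ys. t b)) * (w b i * inj_sum w ys (I - {i})))"
    by (simp add: sum_distrib_left)
  \<comment> \<open>The index \<open>i\<close> taken by \<open>b\<close> merges with it and uses up
    \<open>t b\<close>; what remains is the same product over \<open>I - {i}\<close>.\<close>
  also have "\<dots> = (\<Sum>i\<in>I. w (b + a) i * inj_sum w ys (I - {i}) +
      w b i * ((?s (I - {i}) - ?T) * inj_sum w ys (I - {i})))"
  proof (intro sum.cong refl)
    fix i assume "i \<in> I"
    then have "?s I = w a i + ?s (I - {i})" using Cons.prems by (simp add: sum.remove)
    then show "(?s I - (\<Sum>b\<leftarrow>b # ys. t b)) * (w b i * inj_sum w ys (I - {i})) =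
      w (b + a) i * inj_sum w ys (I - {i}) + w b i * ((?s (I - {i}) - ?T) * inj_sum w ys (I - {i}))"
      by (simp only: w[symmetric] sum_list.Cons list.map) (simp add: algebra_simps)
  qed
  also have "\<dots> = (\<Sum>i\<in>I. w (b + a) i * inj_sum w ys (I - {i}) + w b i *
      (inj_sum w (a # ys) (I - {i}) + (\<Sum>j<length ys. inj_sum w (ys[j := ys ! j + a]) (I - {i}))))"
    using Cons by simp
  also have "\<dots> = inj_sum w ((b + a) # ys) I + inj_sum w (b # a # ys) I
      + (\<Sum>j<length ys. inj_sum w (b # ys[j := ys ! j + a]) I)"
  proof -
    have "(\<Sum>i\<in>I. w b i * (\<Sum>j<length ys. inj_sum w (ys[j := ys ! j + a]) (I - {i}))) =
       (\<Sum>j<length ys. inj_sum w (b # ys[j := ys ! j + a]) I)"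
      by (simp add: sum_distrib_left sum.swap[of _ "{..<length ys}" I])
    then show ?thesis by (simp add: distrib_left sum.distrib del: inj_sum.simps(1))
  qed
  finally show ?case
    unfolding sum_list_update_Cons[of "\<lambda>l. inj_sum w l I"] inj_sum_swap[OF Cons.prems, of w a b] by (simp only: add_ac)
qed simp

text \<open>The product rule solved for the longer list: the augmented monomial as a polynomial in
  \<open>q 1, q 2, ...\<close>. The lists on the right are one entry shorter, hence the inductions
  on the length. \<open>q\<close> may be any sequence, in particular one with a prescribed
  \<open>q 1\<close>.\<close>

fun aug_poly :: "(nat \<Rightarrow> real) \<Rightarrow> nat list \<Rightarrow> real" where
  "aug_poly q [] = 1"
| "aug_poly q (a # xs) = q a * aug_poly q xs - (\<Sum>j<length xs. aug_poly q (xs[j := xs ! j + a]))"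

lemma positive_list_update:
  "a > 0 \<Longrightarrow> 0 \<notin> set xs \<Longrightarrow> 0 \<notin> set (xs[j := xs ! j + a])" for a :: nat
  by (metis add_gr_0 bot_nat_0.not_eq_extremum insert_iff set_update_subset_insert subset_iff)

lemma aug_poly_cong:
  assumes "\<And>a. a > 0 \<Longrightarrow> q a = q' a"
  shows "0 \<notin> set xs \<Longrightarrow> aug_poly q xs = aug_poly q' xs"
proof (induction xs rule: length_induct)
  case (1 xs)
  show ?case
  proof (cases xs)
    case (Cons a ys)
    with 1 have a: "a > 0" "0 \<notin> set ys" by auto
    then show ?thesis using 1 Cons assms positive_list_update[OF a] by simp
  qed simp
qed

text \<open>If \<open>q\<close> comes from finitely many coordinates, the recursion is
  \<open>inj_sum_mult\<close> for powers, so a sum without signs results.\<close>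

lemma aug_poly_inj_sum:
  assumes "finite I"
    and "\<And>a. a > 0 \<Longrightarrow> q a = (\<Sum>i\<in>I. x i ^ a)"
  shows "0 \<notin> set xs \<Longrightarrow> aug_poly q xs = inj_sum (\<lambda>a i. x i ^ a) xs I"
proof (induction xs rule: length_induct)
  case (1 xs)
  show ?case
  proof (cases xs)
    case (Cons a ys)
    then have a: "a > 0" "0 \<notin> set ys" using 1 by auto
    have "aug_poly q xs = q a * inj_sum (\<lambda>a i. x i ^ a) ys I
      - (\<Sum>j<length ys. inj_sum (\<lambda>a i. x i ^ a) (ys[j := ys ! j + a]) I)"
      using 1 Cons a positive_list_update[OF a(1) a(2)] by simp
    also have "\<dots> = inj_sum (\<lambda>a i. x i ^ a) xs I"
      using inj_sum_mult[OF assms(1), of "\<lambda>a i. x i ^ a" a "\<lambda>_. 0" ys] assms(2)[OF a(1)] Cons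
      by (simp add: power_add)
    finally show ?thesis .
  qed simp
qed

section \<open>The simplex\<close>

text \<open>The value 1 at \<open>k = 1\<close> is the one prescribed for \<open>chi p\<close>; it
  includes the mass lost to infinitely many small coordinates and may exceed the sum of
  \<open>p\<close>.\<close>

definition power_sums :: "(nat \<Rightarrow> real) \<Rightarrow> nat \<Rightarrow> real" where
  "power_sums p k = (if k = 1 then 1 else suminf (\<lambda>i. p i ^ k))"

text \<open>Bounds on partial sums are closed conditions on finitely many coordinates, as
  compactness requires.\<close>

lemma nabla_infty_iff:
  "p \<in> nabla_infty \<longleftrightarrow> decseq p \<and> (\<forall>i. 0 \<le> p i) \<and> (\<forall>n. (\<Sum>i<n. p i) \<le> 1)"
proof (intro iffI conjI)
  assume *: "decseq p \<and> (\<forall>i. 0 \<le> p i) \<and> (\<forall>n. (\<Sum>i<n. p i) \<le> 1)"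
  then have "summable p" by (intro summableI_nonneg_bounded[of p 1]) auto
  then show "p \<in> nabla_infty" using * by (auto simp: nabla_infty_def intro!: suminf_le_const)
next
  assume "p \<in> nabla_infty"
  then show "\<forall>n. (\<Sum>i<n. p i) \<le> 1"
    by (auto simp: nabla_infty_def intro!: order_trans[OF sum_le_suminf, of p])
qed (auto simp: nabla_infty_def)

lemma nabla_nonneg: "p \<in> nabla_infty \<Longrightarrow> 0 \<le> p i"
  by (simp add: nabla_infty_iff)

text \<open>The first \<open>i + 1\<close> coordinates are at least \<open>p i\<close> and sum to at
  most 1. The decay is uniform in \<open>p\<close>.\<close>

lemma nabla_le_inverse:
  assumes "p \<in> nabla_infty" shows "p i \<le> inverse (real (Suc i))"
proof -
  have "real (Suc i) * p i = (\<Sum>j<Suc i. p i)" by simp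
  also have "\<dots> \<le> (\<Sum>j<Suc i. p j)"
    using assms by (intro sum_mono) (auto simp: nabla_infty_iff decseq_def)
  also have "\<dots> \<le> 1" using assms unfolding nabla_infty_iff by blast
  finally show ?thesis by (simp add: field_simps)
qed

lemma nabla_le_1: "p \<in> nabla_infty \<Longrightarrow> p i \<le> 1"
  by (rule order_trans[OF nabla_le_inverse]) (auto simp: inverse_le_1_iff)

lemma nabla_summable_power:
  assumes "p \<in> nabla_infty" "k > 0" shows "summable (\<lambda>i. p i ^ k)"
proof (rule summable_comparison_test')
  show "summable p" using assms by (simp add: nabla_infty_def)
  show "norm (p i ^ k) \<le> p i" for i
    using nabla_le_1[OF assms(1), of i] nabla_nonneg[OF assms(1), of i] power_decreasing[of 1 k "p i"] assms(2)
    by (simp)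
qed

lemma power_sums_nonneg: "p \<in> nabla_infty \<Longrightarrow> k > 0 \<Longrightarrow> 0 \<le> power_sums p k"
  by (auto simp: power_sums_def nabla_nonneg intro!: suminf_nonneg nabla_summable_power)

lemma power_sums_le_1:
  assumes "p \<in> nabla_infty" "k > 0" shows "power_sums p k \<le> 1"
proof -
  have "suminf (\<lambda>i. p i ^ k) \<le> suminf (\<lambda>i. p i ^ 1)"
    using assms nabla_nonneg nabla_le_1 by (intro suminf_le nabla_summable_power power_decreasing) auto
  also have "\<dots> \<le> 1" using assms by (simp add: nabla_infty_def)
  finally show ?thesis by (simp add: power_sums_def)
qed

text \<open>A closed subset of a product of unit intervals, compact by Tychonoff's theorem.\<close>

lemma compact_nabla: "compact nabla_infty"
proof -
  have C: "continuous_on UNIV (\<lambda>p :: nat \<Rightarrow> real. p i)" for i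
    by (rule continuous_on_product_coordinates)
  have eq: "nabla_infty = (\<Inter>i. \<Inter>j\<in>{i..}. {p. p j \<le> p i}) \<inter> (\<Inter>i. {p. 0 \<le> p i}) \<inter> (\<Inter>n. {p. (\<Sum>i<n. p i) \<le> 1})"
    by (auto simp: nabla_infty_iff decseq_def)
  have "closed nabla_infty"
    unfolding eq by (intro closed_Int closed_INT ballI closed_Collect_le C continuous_intros)
  moreover have "compact (PiE UNIV (\<lambda>_::nat. {0..1::real}))"
    using compactin_PiE[of "\<lambda>_. euclidean" UNIV "\<lambda>_::nat. {0..1::real}"]
    by (simp add: euclidean_product_topology)
  moreover have "nabla_infty \<subseteq> PiE UNIV (\<lambda>_. {0..1})"
    using nabla_nonneg nabla_le_1 by auto
  ultimately show ?thesis by (metis compact_Int_closed inf.absorb_iff2)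
qed

text \<open>For \<open>k \<ge> 2\<close> the uniform decay of the coordinates dominates the series
  by a convergent one independent of \<open>p\<close>; for \<open>k = 1\<close> the function is
  constant by convention.\<close>

lemma continuous_on_power_sums:
  assumes "k > 0" shows "continuous_on nabla_infty (\<lambda>p. power_sums p k)"
proof (cases "k = 1")
  case False
  with assms have k: "k \<ge> 2" by simp
  have "continuous_on nabla_infty (\<lambda>p. suminf (\<lambda>i. p i ^ k))"
  proof (rule uniform_limit_theorem)
    show "uniform_limit nabla_infty (\<lambda>n p. \<Sum>i<n. p i ^ k) (\<lambda>p. suminf (\<lambda>i. p i ^ k)) sequentially"
    proof (rule Weierstrass_m_test)
      fix n and p :: "nat \<Rightarrow> real" assume "p \<in> nabla_infty"
      then show "norm (p n ^ k) \<le> inverse (real (Suc n) ^ k)"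
        using power_mono[OF nabla_le_inverse, of p n k] nabla_nonneg[of p n]
        by (simp add: power_inverse)
    next
      show "summable (\<lambda>n. inverse (real (Suc n) ^ k))"
        using inverse_power_summable[OF k, where 'a=real] summable_Suc_iff[of "\<lambda>n. inverse (real n ^ k)"] by simp
    qed
    show "\<forall>\<^sub>F n in sequentially. continuous_on nabla_infty (\<lambda>p. \<Sum>i<n. p i ^ k)"
      by (intro always_eventually allI continuous_intros continuous_on_subset[OF continuous_on_product_coordinates]) auto
  qed simp
  then show ?thesis using False by (simp add: power_sums_def)
qed (simp add: power_sums_def)

lemma continuous_on_aug_poly:
  "0 \<notin> set xs \<Longrightarrow> continuous_on nabla_infty (\<lambda>p. aug_poly (power_sums p) xs)"
proof (induction xs rule: length_induct)
  case (1 xs)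
  show ?case
  proof (cases xs)
    case (Cons a ys)
    with 1 have a: "a > 0" "0 \<notin> set ys" by auto
    then show ?thesis using 1 Cons positive_list_update[OF a]
      by (auto intro!: continuous_intros continuous_on_power_sums)
  qed simp
qed

section \<open>Power sums of degree at least 2 separate the points of the simplex\<close>

lemma nabla_power_tail_le:
  assumes p: "p \<in> nabla_infty" and "k \<ge> 1"
  shows "suminf (\<lambda>i. p (i + n) ^ k) \<le> p n ^ (k - 1)"
proof -
  have S: "summable (\<lambda>i. p (i + n))" "suminf (\<lambda>i. p (i + n)) \<le> 1"
  proof -
    have s: "summable p" using p by (simp add: nabla_infty_def)
    then show "summable (\<lambda>i. p (i + n))" by (simp add: summable_iff_shift)
    have "suminf (\<lambda>i. p (i + n)) = suminf p - (\<Sum>i<n. p i)" using suminf_minus_initial_segment[OF s] .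
    moreover have "(\<Sum>i<n. p i) \<ge> 0" using p by (simp add: sum_nonneg nabla_nonneg)
    ultimately show "suminf (\<lambda>i. p (i + n)) \<le> 1" using p by (auto simp: nabla_infty_def)
  qed
  \<comment> \<open>One factor is kept, to sum to at most 1; the others are bounded by
    \<open>p n\<close>, the largest coordinate of the tail.\<close>
  have "suminf (\<lambda>i. p (i + n) ^ k) \<le> suminf (\<lambda>i. p n ^ (k - 1) * p (i + n))"
  proof (rule suminf_le)
    fix i
    have "p (i + n) ^ k = p (i + n) ^ (k - 1) * p (i + n)"
      using assms(2) by (metis One_nat_def Suc_le_D diff_Suc_1 power_Suc2)
    also have "\<dots> \<le> p n ^ (k - 1) * p (i + n)"
      using p by (intro mult_right_mono power_mono) (auto simp: nabla_infty_iff decseq_def)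
    finally show "p (i + n) ^ k \<le> p n ^ (k - 1) * p (i + n)" .
    show "summable (\<lambda>i. p (i + n) ^ k)"
      using nabla_summable_power[OF p, of k] assms(2) by (subst summable_iff_shift) auto
  qed (intro summable_mult S)
  also have "\<dots> = p n ^ (k - 1) * suminf (\<lambda>i. p (i + n))" by (intro suminf_mult S)
  also have "\<dots> \<le> p n ^ (k - 1)" using S(2) p by (simp add: mult_left_le nabla_nonneg)
  finally show ?thesis .
qed

text \<open>Without the common initial coordinates the tails still have equal power sums, so
  \<open>p n ^ k \<le> p' n ^ (k - 1)\<close> for all \<open>k \<ge> 2\<close>. Were
  \<open>p n\<close> larger than \<open>p' n\<close>, this would fail for large
  \<open>k\<close>.\<close>

lemma nabla_power_sums_le:
  assumes p: "p \<in> nabla_infty" and p': "p' \<in> nabla_infty"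
    and eq: "\<And>k. k \<ge> 2 \<Longrightarrow> power_sums p k = power_sums p' k"
    and init: "\<And>j. j < n \<Longrightarrow> p j = p' j"
  shows "p n \<le> p' n"
proof (rule ccontr)
  assume "\<not> p n \<le> p' n"
  then have lt: "p' n < p n" by simp
  have *: "p n ^ k \<le> p' n ^ (k - 1)" if "k \<ge> 2" for k
  proof -
    have s: "summable (\<lambda>i. p i ^ k)" "summable (\<lambda>i. p' i ^ k)"
      using that p p' by (auto intro!: nabla_summable_power)
    have sp: "summable (\<lambda>i. p (i + n) ^ k)" using s(1) by (subst summable_iff_shift)
    have "p n ^ k \<le> suminf (\<lambda>i. p (i + n) ^ k)"
      using sum_le_suminf[OF sp, of "{0}"] p by (auto simp: nabla_nonneg)
    also have "\<dots> = suminf (\<lambda>i. p' (i + n) ^ k)"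
      using suminf_minus_initial_segment[OF s(1), of n] suminf_minus_initial_segment[OF s(2), of n]
        eq[OF that] that init by (simp add: power_sums_def)
    also have "\<dots> \<le> p' n ^ (k - 1)" using that by (intro nabla_power_tail_le p') auto
    finally show ?thesis .
  qed
  have pos: "p n > 0" using lt nabla_nonneg[OF p', of n] by simp
  have "p' n > 0"
    using *[of 2] pos nabla_nonneg[OF p', of n] by (smt (verit) diff_add_inverse2 nat_1_add_1 order_refl power_one_right zero_less_power)
  then have r: "p n / p' n > 1" using lt by simp
  obtain k where k: "1 / p n < (p n / p' n) ^ k" using real_arch_pow[OF r] by blast
  \<comment> \<open>The exponent is raised by one because the bound is applied at
    \<open>k + 2\<close>, where it reads
    \<open>p n * (p n / p' n) ^ (k + 1) \<le> 1\<close>.\<close>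
  have "(p n / p' n) ^ Suc k > 1 / p n" using k r
    by (smt (verit) lessI less_trans power_strict_increasing_iff)
  moreover have "p n ^ Suc (Suc k) \<le> p' n ^ Suc k" using *[of "Suc (Suc k)"] by simp
  then have "p n * (p n / p' n) ^ Suc k \<le> 1" using \<open>p' n > 0\<close>
    by (simp add: power_divide field_simps)
  ultimately show False using pos by (simp add: field_simps)
qed

lemma power_sums_inject:
  assumes p: "p \<in> nabla_infty" and p': "p' \<in> nabla_infty"
    and eq: "\<And>k. k \<ge> 2 \<Longrightarrow> power_sums p k = power_sums p' k"
  shows "p = p'"
proof
  fix n show "p n = p' n"
  proof (induction n rule: less_induct)
    case (less n)
    then show ?case
      using nabla_power_sums_le[OF p p' eq, of n] nabla_power_sums_le[OF p' p eq[symmetric], of n]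
      by force
  qed
qed

section \<open>Partitions\<close>

lemma zero_notin_parts [simp]: "0 \<notin># parts \<rho>"
  using parts[of \<rho>] by simp

definition part_list :: "int_partition \<Rightarrow> nat list" where
  "part_list \<rho> = rev (sorted_list_of_multiset (parts \<rho>))"

text \<open>Meaningful for lists without 0, since \<open>Partition\<close> is unspecified on other
  multisets. Lists in any order are allowed, so that enlarging a part is a list update.\<close>

definition partition_of :: "nat list \<Rightarrow> int_partition" where
  "partition_of xs = Partition (mset xs)"

lemma mset_part_list [simp]: "mset (part_list \<rho>) = parts \<rho>"
  by (simp add: part_list_def)

lemma zero_notin_part_list [simp]: "0 \<notin> set (part_list \<rho>)"
  by (simp flip: set_mset_mset)

lemma parts_partition_of [simp]: "0 \<notin> set xs \<Longrightarrow> parts (partition_of xs) = mset xs"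
  by (simp add: partition_of_def Partition_inverse)

lemma partition_of_part_list [simp]: "partition_of (part_list \<rho>) = \<rho>"
  by (simp add: partition_of_def parts_inverse)

lemma partition_of_eq_iff: "0 \<notin> set xs \<Longrightarrow> partition_of xs = \<rho> \<longleftrightarrow> mset xs = parts \<rho>"
  by (metis parts_inject parts_partition_of)

lemma psize_partition_of [simp]: "0 \<notin> set xs \<Longrightarrow> psize (partition_of xs) = sum_list xs"
  by (simp add: psize_def sum_mset_sum_list)

lemma sum_list_part_list [simp]: "sum_list (part_list \<rho>) = psize \<rho>"
  by (metis partition_of_part_list psize_partition_of zero_notin_part_list)

lemma empty_partition_eq: "empty_partition = partition_of []"
  by (simp add: empty_partition_def partition_of_def)

lemma nth_part_eq: "nth_part \<rho> i = (if i < length (part_list \<rho>) then part_list \<rho> ! i else 0)"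
  by (simp add: nth_part_def part_list_def Let_def)

lemma decseq_nth_part: "decseq (nth_part \<rho>)"
proof -
  have "sorted (rev (part_list \<rho>))" by (simp add: part_list_def)
  then show ?thesis
    unfolding decseq_def nth_part_eq by (auto simp: sorted_rev_iff_nth_mono)
qed

lemma image_nth_part:
  "image_mset (nth_part \<rho>) (mset_set {..<length (part_list \<rho>)}) = parts \<rho>"
proof -
  have "image_mset (nth_part \<rho>) (mset_set {..<length (part_list \<rho>)}) =
      image_mset (\<lambda>i. part_list \<rho> ! i) (mset_set {..<length (part_list \<rho>)})"
    by (intro image_mset_cong) (auto simp: nth_part_eq)
  also have "\<dots> = mset (map (\<lambda>i. part_list \<rho> ! i) [0..<length (part_list \<rho>)])"
    by (simp add: mset_map[symmetric] mset_upt lessThan_atLeast0 del: map_nth)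
  finally show ?thesis by (simp add: map_nth)
qed

lemma sum_nth_part: "(\<Sum>i<length (part_list \<rho>). nth_part \<rho> i) = psize \<rho>"
  unfolding psize_def by (subst image_nth_part[symmetric]) (simp add: sum_unfold_sum_mset)

text \<open>There are at most \<open>n\<close> parts, each at most \<open>n\<close>. Sums over a
  level are therefore genuine finite sums.\<close>

lemma finite_psize_le: "finite {\<rho>. psize \<rho> \<le> n}"
proof (rule finite_subset)
  have le: "length xs \<le> sum_list xs" if "0 \<notin> set xs" for xs :: "nat list"
    using that by (induction xs) auto
  show "{\<rho>. psize \<rho> \<le> n} \<subseteq> partition_of ` {xs. set xs \<subseteq> {..n} \<and> length xs \<le> n}"
  proof
    fix \<rho> assume \<rho>: "\<rho> \<in> {\<rho>. psize \<rho> \<le> n}"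
    then have "set (part_list \<rho>) \<subseteq> {..n}"
      using member_le_sum_list[of _ "part_list \<rho>"] by fastforce
    moreover have "length (part_list \<rho>) \<le> n"
      using le[of "part_list \<rho>"] \<rho> by simp
    ultimately show "\<rho> \<in> partition_of ` {xs. set xs \<subseteq> {..n} \<and> length xs \<le> n}"
      by (intro image_eqI[of _ _ "part_list \<rho>"]) auto
  qed
  show "finite (partition_of ` {xs. set xs \<subseteq> {..n} \<and> length xs \<le> n})"
    by (intro finite_imageI finite_lists_length_le) auto
qed

lemma finite_psize_eq [simp]: "finite {\<rho>. psize \<rho> = n}"
  by (rule finite_subset[OF _ finite_psize_le[of n]]) auto

section \<open>Partitions as points of the simplex\<close>

definition scaled :: "int_partition \<Rightarrow> nat \<Rightarrow> real" where
  "scaled \<rho> i = real (nth_part \<rho> i) / real (psize \<rho>)"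

lemma scaled_in_nabla: "scaled \<rho> \<in> nabla_infty"
proof -
  have "(\<Sum>i<n. nth_part \<rho> i) \<le> psize \<rho>" for n
  proof -
    have "(\<Sum>i<n. nth_part \<rho> i) \<le> (\<Sum>i<max n (length (part_list \<rho>)). nth_part \<rho> i)"
      by (intro sum_mono2) auto
    also have "\<dots> = (\<Sum>i<length (part_list \<rho>). nth_part \<rho> i)"
      by (intro sum.mono_neutral_right) (auto simp: nth_part_eq)
    finally show ?thesis by (simp add: sum_nth_part)
  qed
  \<comment> \<open>For the empty partition, division by 0 gives the zero sequence.\<close>
  then have "(\<Sum>i<n. scaled \<rho> i) \<le> 1" for n
    unfolding scaled_def sum_divide_distrib[symmetric] of_nat_sum[symmetric]
    by (cases "psize \<rho> = 0") (auto simp del: of_nat_sum)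
  then show ?thesis
    using decseq_nth_part[of \<rho>]
    by (auto simp: nabla_infty_iff decseq_def scaled_def intro!: divide_right_mono)
qed

text \<open>The scaled parts of a nonempty partition sum to 1, so here the conventional first power
  sum is the actual one.\<close>

lemma power_sums_scaled:
  assumes "psize \<rho> > 0" "a > 0"
  shows "power_sums (scaled \<rho>) a = (\<Sum>i<length (part_list \<rho>). scaled \<rho> i ^ a)"
proof (cases "a = 1")
  case True
  then show ?thesis using assms
    by (simp add: power_sums_def scaled_def sum_divide_distrib[symmetric] of_nat_sum[symmetric] sum_nth_part
        del: of_nat_sum)
next
  case False
  have "suminf (\<lambda>i. scaled \<rho> i ^ a) = (\<Sum>i<length (part_list \<rho>). scaled \<rho> i ^ a)"
    by (rule suminf_finite) (use assms in \<open>auto simp: scaled_def nth_part_eq\<close>)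
  then show ?thesis using False by (simp add: power_sums_def)
qed

lemma nth_part_partition_of:
  assumes "sorted (rev xs)" "0 \<notin> set xs"
  shows "nth_part (partition_of xs) i = (if i < length xs then xs ! i else 0)"
proof -
  have "part_list (partition_of xs) = xs"
    using assms sorted_list_of_multiset_mset[of "rev xs"] sort_key_id_if_sorted
    by (simp add: part_list_def sorted_sort_id)
  then show ?thesis by (simp add: nth_part_eq)
qed

text \<open>Round every \<open>N * p i\<close> down, then restore the size by parts 1 placed behind
  the nonzero floors, where they keep the order.\<close>

lemma exists_partition_near:
  assumes p: "p \<in> nabla_infty"
  shows "\<exists>\<rho>. psize \<rho> = N \<and> (\<forall>i. \<bar>real (nth_part \<rho> i) - real N * p i\<bar> \<le> 1)"
proof -
  define f where "f i = nat \<lfloor>real N * p i\<rfloor>" for i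
  have np: "0 \<le> real N * p i" for i using nabla_nonneg[OF p, of i] by simp
  have anti: "f j \<le> f i" if "i \<le> j" for i j
    using that p unfolding f_def nabla_infty_iff decseq_def
    by (intro nat_mono floor_mono mult_left_mono) auto
  \<comment> \<open>Since \<open>p N \<le> 1 / (N + 1)\<close>, nonzero floors occur only at indices
    below \<open>N\<close>.\<close>
  have fN: "f N = 0"
  proof -
    have "real N * p N \<le> real N * inverse (real (Suc N))"
      by (intro mult_left_mono nabla_le_inverse[OF p]) auto
    also have "\<dots> < 1" by (simp add: field_simps)
    finally show ?thesis using np[of N] by (auto simp: f_def)
  qed
  define K where "K = (LEAST k. f k = 0)"
  have fK: "f K = 0" unfolding K_def using fN by (rule LeastI)
  have f0: "f i = 0" if "i \<ge> K" for i using anti[OF that] fK by simp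
  have fpos: "f i > 0" if "i < K" for i using not_less_Least[of i "\<lambda>k. f k = 0"] that K_def by auto
  have rf: "real (f i) \<le> real N * p i" "real N * p i < real (f i) + 1" for i
    using np[of i] unfolding f_def by (simp_all; linarith)+
  have "real (\<Sum>i<K. f i) \<le> (\<Sum>i<K. real N * p i)"
    unfolding of_nat_sum by (intro sum_mono rf)
  also have "\<dots> \<le> real N * 1"
    unfolding sum_distrib_left[symmetric] using p by (intro mult_left_mono) (auto simp: nabla_infty_iff)
  finally have sum_le: "(\<Sum>i<K. f i) \<le> N" by linarith
  define r where "r = N - (\<Sum>i<K. f i)"
  define xs where "xs = map f [0..<K] @ replicate r 1"
  have xs0: "0 \<notin> set xs" using fpos by (force simp: xs_def)
  have "sorted_wrt (\<ge>) (map f [0..<K])"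
    by (auto simp: sorted_wrt_iff_nth_less intro!: anti)
  then have "sorted (rev xs)" using fpos
    by (auto simp: xs_def sorted_wrt_rev sorted_wrt_append sorted_wrt_iff_nth_less[of _ "replicate r _"] Suc_le_eq)
  then have nth: "nth_part (partition_of xs) i = (if i < length xs then xs ! i else 0)" for i
    by (rule nth_part_partition_of) (rule xs0)
  have "\<bar>real (nth_part (partition_of xs) i) - real N * p i\<bar> \<le> 1" for i
  proof (cases "i < K")
    case True
    then show ?thesis using rf[of i] unfolding nth by (simp add: xs_def nth_append)
  next
    case False
    \<comment> \<open>From \<open>K\<close> on the floors are 0, so \<open>N * p i\<close> lies
      between 0 and 1 and any part 0 or 1 is close enough.\<close>
    then have "nth_part (partition_of xs) i \<le> 1" unfolding nth by (simp add: xs_def nth_append)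
    then show ?thesis using rf[of i] f0[of i] False np[of i] by simp
  qed
  moreover have "psize (partition_of xs) = N"
    using xs0 sum_le by (simp add: xs_def r_def sum_list_replicate interv_sum_list_conv_sum_set_nat atLeast0LessThan)
  ultimately show ?thesis by blast
qed

text \<open>Density of the scaled partitions: statements about finite sums pass to every
  \<open>p\<close> by continuity.\<close>

lemma exists_approximating_partitions:
  assumes p: "p \<in> nabla_infty"
  obtains \<rho> where "\<And>N. psize (\<rho> N) = N" "(\<lambda>N. scaled (\<rho> N)) \<longlonglongrightarrow> p"
proof -
  obtain \<rho> where \<rho>: "\<And>N. psize (\<rho> N) = N" "\<And>N i. \<bar>real (nth_part (\<rho> N) i) - real N * p i\<bar> \<le> 1"
    using exists_partition_near[OF p] by metis
  have "(\<lambda>N. scaled (\<rho> N) i) \<longlonglongrightarrow> p i" for i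
  proof (rule LIM_zero_cancel, rule Lim_null_comparison)
    show "\<forall>\<^sub>F N in sequentially. norm (scaled (\<rho> N) i - p i) \<le> inverse (real N)"
      using eventually_gt_at_top[of 0]
    proof eventually_elim
      case (elim N)
      have "scaled (\<rho> N) i - p i = (real (nth_part (\<rho> N) i) - real N * p i) / real N"
        using elim by (simp add: scaled_def \<rho>(1) diff_divide_distrib)
      then have "\<bar>scaled (\<rho> N) i - p i\<bar> = \<bar>real (nth_part (\<rho> N) i) - real N * p i\<bar> / real N"
        by simp
      then show ?case using \<rho>(2)[of N i] elim by (simp add: field_simps)
    qed
    show "(\<lambda>N. inverse (real N)) \<longlonglongrightarrow> 0" by (rule lim_inverse_n)
  qed
  then have "(\<lambda>N. scaled (\<rho> N)) \<longlonglongrightarrow> p"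
    using limitin_componentwise[of "\<lambda>_. euclidean" UNIV "\<lambda>N. scaled (\<rho> N)" p sequentially]
    by (simp add: euclidean_product_topology)
  with \<rho>(1) show thesis by (rule that)
qed

section \<open>Symmetric functions\<close>

abbreviation "exponent \<equiv> Poly_Mapping.lookup"
abbreviation "supp \<equiv> Poly_Mapping.keys"

text \<open>The type of a monomial up to renaming of variables, which is all that a symmetric
  function sees of it.\<close>

definition exponents :: "monomial \<Rightarrow> nat multiset" where
  "exponents \<alpha> = image_mset (exponent \<alpha>) (mset_set (supp \<alpha>))"

lemma zero_notin_exponents [simp]: "0 \<notin># exponents \<alpha>"
  by (auto simp: exponents_def in_keys_iff)

lemma mdegree_eq: "mdegree \<alpha> = \<Sum>\<^sub># (exponents \<alpha>)"
  by (simp add: mdegree_def exponents_def sum_unfold_sum_mset)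

lemma exponents_remove:
  "exponents \<alpha> = image_mset (exponent \<alpha>) (mset_set (supp \<alpha> - {i})) +
     (if exponent \<alpha> i = 0 then {#} else {#exponent \<alpha> i#})"
proof (cases "i \<in> supp \<alpha>")
  case True
  then have "mset_set (supp \<alpha>) = add_mset i (mset_set (supp \<alpha> - {i}))"
    by (simp add: mset_set.remove)
  then show ?thesis using True by (simp add: exponents_def in_keys_iff)
qed (simp add: exponents_def in_keys_iff)

lemma exponents_minus_single:
  assumes "exponent \<alpha> i \<ge> a" "a > 0"
  shows "exponents (\<alpha> - Poly_Mapping.single i a) =
     exponents \<alpha> - {#exponent \<alpha> i#} + (if exponent \<alpha> i = a then {#} else {#exponent \<alpha> i - a#})"
proof -
  let ?\<gamma> = "\<alpha> - Poly_Mapping.single i a"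
  have off: "exponent ?\<gamma> j = exponent \<alpha> j" if "j \<noteq> i" for j
    using that by (simp add: lookup_minus lookup_single)
  have "supp ?\<gamma> - {i} = supp \<alpha> - {i}"
    using off by (auto simp: in_keys_iff)
  moreover have "image_mset (exponent ?\<gamma>) (mset_set (supp \<alpha> - {i})) = image_mset (exponent \<alpha>) (mset_set (supp \<alpha> - {i}))"
    using off by (intro image_mset_cong) auto
  ultimately show ?thesis
    using assms by (subst exponents_remove[of ?\<gamma> i], subst exponents_remove[of \<alpha> i]) (simp add: lookup_minus lookup_single)
qed

lemma exponents_map_key:
  assumes "bij \<pi>" shows "exponents (Poly_Mapping.map_key \<pi> \<alpha>) = exponents \<alpha>"
proof -
  have inj: "inj \<pi>" using assms bij_is_inj by blast
  have "supp \<alpha> = \<pi> ` (\<pi> -` supp \<alpha>)" using assms by (simp add: bij_is_surj surj_image_vimage_eq)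
  then have "mset_set (supp \<alpha>) = image_mset \<pi> (mset_set (\<pi> -` supp \<alpha>))"
    using image_mset_mset_set[OF inj_on_subset[OF inj subset_UNIV], of "\<pi> -` supp \<alpha>"] by simp
  then show ?thesis
    by (simp add: exponents_def keys_map_key[OF inj] map_key.rep_eq[OF inj] image_mset.compositionality)
qed

lemma mset_exponents_upto:
  assumes "supp \<alpha> \<subseteq> {..<n}"
  shows "mset (map (exponent \<alpha>) [0..<n]) = exponents \<alpha> + replicate_mset (n - size (exponents \<alpha>)) 0"
proof -
  have "mset_set {..<n} = mset_set (supp \<alpha>) + mset_set ({..<n} - supp \<alpha>)"
    using assms by (subst mset_set_Union[symmetric]) (auto intro!: arg_cong[of _ _ mset_set])
  moreover have "image_mset (exponent \<alpha>) (mset_set ({..<n} - supp \<alpha>)) = replicate_mset (n - card (supp \<alpha>)) 0"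
    using assms
    by (subst image_mset_cong[of _ _ "\<lambda>_. 0"])
      (auto simp: in_keys_iff image_mset_const_eq card_Diff_subset)
  ultimately show ?thesis
    by (simp add: exponents_def mset_map mset_upt atLeast0LessThan)
qed

text \<open>On a range containing both supports the exponent lists, padded by zeros, are
  rearrangements of each other; the rearrangement, extended by the identity, is a bijection of the
  variables.\<close>

lemma symmetric_function_cong:
  assumes f: "f \<in> symmetric_functions" and eq: "exponents \<alpha> = exponents \<beta>"
  shows "f \<alpha> = f \<beta>"
proof -
  obtain n where n: "supp \<alpha> \<union> supp \<beta> \<subseteq> {..<n}"
    using finite_nat_set_iff_bounded[of "supp \<alpha> \<union> supp \<beta>"] by auto
  let ?l = "\<lambda>\<alpha>. map (exponent \<alpha>) [0..<n]"
  have "mset (?l \<beta>) = mset (?l \<alpha>)"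
    using n eq by (simp only: mset_exponents_upto Un_subset_iff)
  then obtain \<pi> where \<pi>: "\<pi> permutes {..<length (?l \<alpha>)}" "permute_list \<pi> (?l \<alpha>) = ?l \<beta>"
    by (rule mset_eq_permutation)
  have bij: "bij \<pi>" using \<pi>(1) permutes_bij by blast
  have "exponent \<alpha> (\<pi> i) = exponent \<beta> i" for i
  proof (cases "i < n")
    case True
    then have "\<pi> i < n" using permutes_in_image[OF \<pi>(1), of i] by simp
    then show ?thesis using permute_list_nth[OF \<pi>(1), of i] \<pi>(2) True by simp
  next
    case False
    then have "\<pi> i = i" using \<pi>(1) by (intro permutes_not_in[OF \<pi>(1)]) auto
    moreover have "i \<notin> supp \<alpha>" "i \<notin> supp \<beta>" using n False by auto
    ultimately show ?thesis by (simp add: in_keys_iff)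
  qed
  then have "Poly_Mapping.map_key \<pi> \<alpha> = \<beta>"
    by (intro poly_mapping_eqI) (simp add: map_key.rep_eq[OF bij_is_inj[OF bij]])
  then show ?thesis using f bij by (auto simp: symmetric_functions_def)
qed

definition multiplicity_factorials :: "nat multiset \<Rightarrow> real" where
  "multiplicity_factorials X = (\<Prod>j\<in>set_mset X. fact (count X j))"

lemma multiplicity_factorials_pos [simp]: "multiplicity_factorials X > 0"
  by (simp add: multiplicity_factorials_def prod_pos)

lemma multiplicity_factorials_add_mset:
  "multiplicity_factorials (add_mset b X) = (real (count X b) + 1) * multiplicity_factorials X"
proof -
  have E: "multiplicity_factorials Y = (\<Prod>j\<in>insert b (set_mset X). fact (count Y j))"
    if "set_mset Y \<subseteq> insert b (set_mset X)" for Y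
    unfolding multiplicity_factorials_def using that
    by (intro prod.mono_neutral_left) (auto simp: not_in_iff)
  have "(\<Prod>j\<in>insert b (set_mset X) - {b}. fact (count (add_mset b X) j)) =
      (\<Prod>j\<in>insert b (set_mset X) - {b}. fact (count X j) :: real)"
    by (intro prod.cong) auto
  then show ?thesis
    by (subst (1 2) E) (auto simp: prod.remove[of _ b])
qed

lemma aug_monomial_sym_eq:
  "aug_monomial_sym \<mu> \<alpha> = (if exponents \<alpha> = parts \<mu> then multiplicity_factorials (parts \<mu>) else 0)"
  by (simp add: aug_monomial_sym_def series_scale_def monomial_sym_def exponents_def
      multiplicity_factorials_def)

lemma aug_monomial_sym_symmetric: "aug_monomial_sym \<mu> \<in> symmetric_functions"
  unfolding symmetric_functions_def
  by (auto simp: aug_monomial_sym_eq exponents_map_key mdegree_eq intro!: exI[of _ "psize \<mu>"])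
    (auto simp: psize_def split: if_splits)

lemma exponents_single: "exponents (Poly_Mapping.single i k) = (if k = 0 then {#} else {#k#})"
  by (simp add: exponents_def)

lemma power_sum_eq:
  assumes "k > 0" shows "power_sum k \<alpha> = (if exponents \<alpha> = {#k#} then 1 else 0)"
proof -
  have "\<exists>i. \<alpha> = Poly_Mapping.single i k" if eq: "exponents \<alpha> = {#k#}"
  proof -
    have "supp \<alpha> \<noteq> {}" using eq by (auto simp: exponents_def)
    then obtain i where i: "i \<in> supp \<alpha>" by blast
    then have "image_mset (exponent \<alpha>) (mset_set (supp \<alpha> - {i})) + {#exponent \<alpha> i#} = {#k#}"
      using exponents_remove[of \<alpha> i] eq by (auto simp: in_keys_iff)
    then have "exponent \<alpha> i = k" "supp \<alpha> - {i} = {}" by (auto simp: mset_set_empty_iff)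
    then have "\<alpha> = Poly_Mapping.single i k"
      by (intro poly_mapping_eqI) (auto simp: lookup_single when_def in_keys_iff)
    then show ?thesis by blast
  qed
  then show ?thesis using assms by (auto simp: power_sum_def exponents_single)
qed

lemma power_sum_symmetric: "k > 0 \<Longrightarrow> power_sum k \<in> symmetric_functions"
  unfolding symmetric_functions_def
  by (auto simp: power_sum_eq exponents_map_key mdegree_eq intro!: exI[of _ k])

lemma series_one_symmetric: "series_one \<in> symmetric_functions"
proof -
  have "series_one \<alpha> = (if exponents \<alpha> = {#} then 1 else 0)" for \<alpha>
    by (simp add: series_one_def exponents_def mset_set_empty_iff)
  then show ?thesis
    by (auto simp: symmetric_functions_def exponents_map_key mdegree_eq intro!: exI[of _ 0])
qed

lemma series_add_symmetric:
  assumes "f \<in> symmetric_functions" "g \<in> symmetric_functions"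
  shows "series_add f g \<in> symmetric_functions"
proof -
  from assms obtain d e where "\<forall>\<alpha>. f \<alpha> \<noteq> 0 \<longrightarrow> mdegree \<alpha> \<le> d" "\<forall>\<alpha>. g \<alpha> \<noteq> 0 \<longrightarrow> mdegree \<alpha> \<le> e"
    by (auto simp: symmetric_functions_def)
  then have "\<forall>\<alpha>. series_add f g \<alpha> \<noteq> 0 \<longrightarrow> mdegree \<alpha> \<le> max d e"
    by (auto simp: series_add_def le_max_iff_disj) (metis add.right_neutral)
  then show ?thesis using assms by (auto simp: symmetric_functions_def series_add_def)
qed

lemma series_scale_symmetric:
  "f \<in> symmetric_functions \<Longrightarrow> series_scale c f \<in> symmetric_functions"
  by (auto simp: symmetric_functions_def series_scale_def)

lemma finite_bounded_monomials:
  assumes "finite I" shows "finite {\<alpha>. supp \<alpha> \<subseteq> I \<and> mdegree \<alpha> \<le> d}"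
proof (rule finite_imageD)
  have "exponent ` {\<alpha>. supp \<alpha> \<subseteq> I \<and> mdegree \<alpha> \<le> d} \<subseteq> {f. \<forall>i. (i \<in> I \<longrightarrow> f i \<in> {..d}) \<and> (i \<notin> I \<longrightarrow> f i = 0)}"
  proof (rule image_subsetI)
    fix \<alpha> assume "\<alpha> \<in> {\<alpha>. supp \<alpha> \<subseteq> I \<and> mdegree \<alpha> \<le> d}"
    then have \<alpha>: "supp \<alpha> \<subseteq> I" "mdegree \<alpha> \<le> d" by auto
    have "exponent \<alpha> i \<le> d" for i
    proof (cases "i \<in> supp \<alpha>")
      case True
      then have "exponent \<alpha> i \<le> mdegree \<alpha>"
        unfolding mdegree_def using finite_keys by (metis member_le_sum le0)
      with \<alpha> show ?thesis by simp
    qed (simp add: in_keys_iff)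
    moreover have "exponent \<alpha> i = 0" if "i \<notin> I" for i
      using \<alpha> that in_keys_iff[of i \<alpha>] by blast
    ultimately show "exponent \<alpha> \<in> {f. \<forall>i. (i \<in> I \<longrightarrow> f i \<in> {..d}) \<and> (i \<notin> I \<longrightarrow> f i = 0)}"
      by simp
  qed
  then show "finite (exponent ` {\<alpha>. supp \<alpha> \<subseteq> I \<and> mdegree \<alpha> \<le> d})"
    by (rule finite_subset) (intro finite_set_of_finite_funs assms finite_atMost)
  show "inj_on exponent {\<alpha>. supp \<alpha> \<subseteq> I \<and> mdegree \<alpha> \<le> d}"
    by (auto simp: inj_on_def lookup_inject)
qed

lemma mdegree_superset: "finite S \<Longrightarrow> supp \<alpha> \<subseteq> S \<Longrightarrow> mdegree \<alpha> = (\<Sum>i\<in>S. exponent \<alpha> i)"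
  unfolding mdegree_def by (intro sum.mono_neutral_left) (auto simp: in_keys_iff)

text \<open>Coefficients of a product are sums over these splittings, and a sum over an infinite set
  would be 0 by convention.\<close>

lemma finite_monomial_splittings: "finite {(\<beta>, \<gamma>). \<beta> + \<gamma> = (\<alpha> :: monomial)}"
proof (rule finite_subset)
  let ?B = "{\<beta>. supp \<beta> \<subseteq> supp \<alpha> \<and> mdegree \<beta> \<le> mdegree \<alpha>}"
  have B: "\<beta> \<in> ?B" if "\<beta> + \<gamma> = \<alpha>" for \<beta> \<gamma>
  proof -
    have le: "exponent \<beta> i \<le> exponent \<alpha> i" for i using that by (auto simp: lookup_add)
    have s: "supp \<beta> \<subseteq> supp \<alpha>"
    proof
      fix i assume "i \<in> supp \<beta>"
      then show "i \<in> supp \<alpha>" using le[of i] by (simp add: in_keys_iff)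
    qed
    have "mdegree \<beta> = (\<Sum>i\<in>supp \<alpha>. exponent \<beta> i)" using s by (intro mdegree_superset) auto
    also have "\<dots> \<le> mdegree \<alpha>" unfolding mdegree_def by (intro sum_mono le)
    finally show ?thesis using s by simp
  qed
  have "\<gamma> \<in> ?B" if "\<beta> + \<gamma> = \<alpha>" for \<beta> \<gamma>
    using B[of \<gamma> \<beta>] that by (simp add: add.commute)
  with B show "{(\<beta>, \<gamma>). \<beta> + \<gamma> = \<alpha>} \<subseteq> ?B \<times> ?B" by blast
  show "finite (?B \<times> ?B)" by (intro finite_cartesian_product finite_bounded_monomials) auto
qed

section \<open>The product rule for formal series\<close>

lemma series_mult_power_sum:
  assumes "a > 0"
  shows "series_mult (power_sum a) f \<alpha> =
    (\<Sum>i | i \<in> supp \<alpha> \<and> a \<le> exponent \<alpha> i. f (\<alpha> - Poly_Mapping.single i a))"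
proof -
  let ?I = "{i. i \<in> supp \<alpha> \<and> a \<le> exponent \<alpha> i}"
  let ?h = "\<lambda>i. (Poly_Mapping.single i a, \<alpha> - Poly_Mapping.single i a)"
  have split: "Poly_Mapping.single i a + (\<alpha> - Poly_Mapping.single i a) = \<alpha>" if "a \<le> exponent \<alpha> i" for i
    using that by (intro poly_mapping_eqI) (auto simp: lookup_add lookup_minus lookup_single when_def)
  have inj: "inj_on ?h ?I"
  proof (rule inj_onI)
    fix i j assume "?h i = ?h j"
    then have "supp (Poly_Mapping.single i a) = supp (Poly_Mapping.single j a)" by simp
    then show "i = j" using assms by simp
  qed
  \<comment> \<open>Only splittings whose first factor is the \<open>a\<close>-th power of a single
    variable contribute.\<close>
  have "(\<Sum>(\<beta>, \<gamma>) | \<beta> + \<gamma> = \<alpha>. power_sum a \<beta> * f \<gamma>) = (\<Sum>(\<beta>, \<gamma>)\<in>?h ` ?I. power_sum a \<beta> * f \<gamma>)"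
  proof (rule sum.mono_neutral_right[OF finite_monomial_splittings])
    show "?h ` ?I \<subseteq> {(\<beta>, \<gamma>). \<beta> + \<gamma> = \<alpha>}" using split by auto
    show "\<forall>x\<in>{(\<beta>, \<gamma>). \<beta> + \<gamma> = \<alpha>} - ?h ` ?I. (case x of (\<beta>, \<gamma>) \<Rightarrow> power_sum a \<beta> * f \<gamma>) = 0"
    proof (rule ballI)
      fix x assume x: "x \<in> {(\<beta>, \<gamma>). \<beta> + \<gamma> = \<alpha>} - ?h ` ?I"
      obtain \<beta> \<gamma> where x_eq: "x = (\<beta>, \<gamma>)" by (cases x)
      with x have n: "(\<beta>, \<gamma>) \<notin> ?h ` ?I" and \<alpha>: "\<alpha> = \<beta> + \<gamma>" by auto
      have "\<beta> \<noteq> Poly_Mapping.single i a" for i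
      proof
        assume \<beta>: "\<beta> = Poly_Mapping.single i a"
        then have "(\<beta>, \<gamma>) = ?h i" using \<alpha> by simp
        moreover have "a \<le> exponent \<alpha> i" by (simp add: \<alpha> \<beta> lookup_add)
        moreover have "i \<in> supp \<alpha>" using assms by (simp add: in_keys_iff \<alpha> \<beta> lookup_add)
        ultimately show False using n by blast
      qed
      then show "(case x of (\<beta>, \<gamma>) \<Rightarrow> power_sum a \<beta> * f \<gamma>) = 0"
        by (simp add: power_sum_def x_eq)
    qed
  qed
  also have "\<dots> = (\<Sum>i\<in>?I. f (\<alpha> - Poly_Mapping.single i a))"
    unfolding sum.reindex[OF inj] by (intro sum.cong) (auto simp: power_sum_def)
  finally show ?thesis by (simp add: series_mult_def)
qed

lemma sum_mset_count:
  fixes g :: "'a \<Rightarrow> real"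
  assumes "finite S" "set_mset X \<subseteq> S"
  shows "(\<Sum>x\<in>#X. g x) = (\<Sum>x\<in>S. real (count X x) * g x)"
  using assms(2)
proof (induction X)
  case (add x X)
  have "(\<Sum>y\<in>S. real (count (add_mset x X) y) * g y) =
      (\<Sum>y\<in>S. (if y = x then g y else 0) + real (count X y) * g y)"
    by (intro sum.cong) (auto simp: algebra_simps)
  then show ?case using add assms(1) by (simp add: sum.distrib)
qed simp

text \<open>Both sides vanish unless \<open>X\<close> and \<open>T\<close> arise from a common
  \<open>Y\<close> by adding \<open>b\<close> and \<open>b + a\<close>. Then both are the factorials
  of \<open>Y\<close> times \<open>count Y b + 1\<close> times
  \<open>count Y (b + a) + 1\<close>.\<close>

lemma multiset_transfer_count:
  assumes "b > 0" and X: "0 \<notin># X" and T: "0 \<notin># T" and "a > 0"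
  shows "multiplicity_factorials X * (real (count T (b + a)) *
      (if b + a \<in># T \<and> T - {#b + a#} + {#b#} = X then 1 else 0)) =
    real (count X b) * (if b \<in># X \<and> T = X - {#b#} + {#b + a#}
      then multiplicity_factorials (X - {#b#} + {#b + a#}) else 0)"
proof (cases "\<exists>Y. X = add_mset b Y \<and> T = add_mset (b + a) Y")
  case True
  then obtain Y where Y: "X = add_mset b Y" "T = add_mset (b + a) Y" by blast
  then show ?thesis using assms(4) by (simp add: multiplicity_factorials_add_mset algebra_simps)
next
  case False
  have "\<not> (b + a \<in># T \<and> T - {#b + a#} + {#b#} = X)"
  proof
    assume *: "b + a \<in># T \<and> T - {#b + a#} + {#b#} = X"
    then have "X = add_mset b (T - {#b + a#})" "T = add_mset (b + a) (T - {#b + a#})" by auto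
    with False show False by blast
  qed
  moreover have "\<not> (b \<in># X \<and> T = X - {#b#} + {#b + a#})"
  proof
    assume *: "b \<in># X \<and> T = X - {#b#} + {#b + a#}"
    then have "X = add_mset b (X - {#b#})" "T = add_mset (b + a) (X - {#b#})" by auto
    with False show False by blast
  qed
  ultimately show ?thesis by (simp only: if_False mult_zero_right)
qed

text \<open>Comparison of coefficients in the product rule at a monomial of type \<open>T\<close>.
  On the left, \<open>a\<close> is removed from an exponent \<open>e\<close>: \<open>e = a\<close>
  corresponds to a new part, \<open>e = b + a\<close> to an enlarged part \<open>b\<close>.\<close>

lemma multiset_aug_identity:
  fixes a :: nat
  assumes a: "a > 0" and X: "0 \<notin># X" and T: "0 \<notin># T"
  defines "M \<equiv> \<lambda>Y. if T = Y then multiplicity_factorials Y else 0"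
  shows "(\<Sum>e\<in>#T. if a \<le> e \<and> T - {#e#} + (if e = a then {#} else {#e - a#}) = X
           then multiplicity_factorials X else 0) =
         M (add_mset a X) + (\<Sum>b\<in>#X. M (add_mset (b + a) (X - {#b#})))"
proof -
  let ?c = multiplicity_factorials
  let ?g = "\<lambda>e. if a \<le> e \<and> T - {#e#} + (if e = a then {#} else {#e - a#}) = X then ?c X else 0"
  obtain K where "set_mset X \<union> set_mset T \<subseteq> {..<K}"
    using finite_nat_set_iff_bounded[of "set_mset X \<union> set_mset T"] by auto
  then have K: "set_mset X \<subseteq> {..<Suc K}" "set_mset T \<subseteq> {..<a + Suc K}" by fastforce+
  have "(\<Sum>e\<in>#T. ?g e) = (\<Sum>e\<in>{..<a + Suc K}. real (count T e) * ?g e)"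
    by (rule sum_mset_count) (use K in auto)
  also have "\<dots> = (\<Sum>e\<in>{a..<a + Suc K}. real (count T e) * ?g e)"
    by (rule sum.mono_neutral_right) auto
  also have "\<dots> = (\<Sum>b<Suc K. real (count T (b + a)) * ?g (b + a))"
    using sum.shift_bounds_nat_ivl[of "\<lambda>e. real (count T e) * ?g e" 0 a "Suc K"]
    by (simp add: atLeast0LessThan add.commute)
  \<comment> \<open>The term \<open>b = 0\<close>, that is \<open>e = a\<close>, is the new part and
    is treated separately.\<close>
  also have "\<dots> = real (count T a) * ?g a + (\<Sum>b<K. real (count T (Suc b + a)) * ?g (Suc b + a))"
    by (simp add: sum.lessThan_Suc_shift del: sum.lessThan_Suc)
  also have "real (count T a) * ?g a = M (add_mset a X)"
  proof (cases "T = add_mset a X")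
    case False
    then have "a \<notin># T \<or> T - {#a#} \<noteq> X" by auto
    then show ?thesis using False by (auto simp: M_def not_in_iff)
  qed (simp add: M_def multiplicity_factorials_add_mset)
  also have "(\<Sum>b<K. real (count T (Suc b + a)) * ?g (Suc b + a)) =
      (\<Sum>b<K. real (count X (Suc b)) * M (add_mset (Suc b + a) (X - {#Suc b#})))"
  proof (rule sum.cong[OF refl])
    fix b
    have "real (count T (Suc b + a)) * ?g (Suc b + a) =
      ?c X * (real (count T (Suc b + a)) * (if Suc b + a \<in># T \<and> T - {#Suc b + a#} + {#Suc b#} = X then 1 else 0))"
      by (auto simp: not_in_iff)
    also have "\<dots> = real (count X (Suc b)) * (if Suc b \<in># X \<and> T = X - {#Suc b#} + {#Suc b + a#}
      then ?c (X - {#Suc b#} + {#Suc b + a#}) else 0)"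
      by (rule multiset_transfer_count) (use assms in auto)
    also have "\<dots> = real (count X (Suc b)) * M (add_mset (Suc b + a) (X - {#Suc b#}))"
      by (auto simp: M_def not_in_iff)
    finally show "real (count T (Suc b + a)) * ?g (Suc b + a) =
      real (count X (Suc b)) * M (add_mset (Suc b + a) (X - {#Suc b#}))" .
  qed
  also have "(\<Sum>b<K. real (count X (Suc b)) * M (add_mset (Suc b + a) (X - {#Suc b#}))) =
      (\<Sum>b<Suc K. real (count X b) * M (add_mset (b + a) (X - {#b#})))"
    using X by (simp add: sum.lessThan_Suc_shift not_in_iff del: sum.lessThan_Suc)
  also have "\<dots> = (\<Sum>b\<in>#X. M (add_mset (b + a) (X - {#b#})))"
    by (rule sum_mset_count[symmetric]) (use K in auto)
  finally show ?thesis .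
qed

lemma sum_updates_eq_sum_mset:
  fixes F :: "nat multiset \<Rightarrow> 'b::comm_monoid_add"
  shows "(\<Sum>j<length xs. F (mset (xs[j := xs ! j + a]))) = (\<Sum>b\<in>#mset xs. F (add_mset (b + a) (mset xs - {#b#})))"
proof -
  have "(\<Sum>j<length xs. F (mset (xs[j := xs ! j + a]))) =
      (\<Sum>j<length xs. (\<lambda>b. F (add_mset (b + a) (mset xs - {#b#}))) (xs ! j))"
    by (intro sum.cong) (auto simp: mset_update)
  also have "\<dots> = (\<Sum>b\<leftarrow>xs. F (add_mset (b + a) (mset xs - {#b#})))"
    by (simp add: sum_list_sum_nth atLeast0LessThan)
  also have "\<dots> = (\<Sum>b\<in>#mset xs. F (add_mset (b + a) (mset xs - {#b#})))"
    by (simp only: mset_map[symmetric] sum_mset_sum_list)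
  finally show ?thesis .
qed

text \<open>The analogue of \<open>inj_sum_mult\<close> for powers in infinitely many variables,
  proved coefficient by coefficient.\<close>

lemma series_mult_power_sum_aug:
  assumes a: "a > 0" and xs: "0 \<notin> set xs"
  shows "series_mult (power_sum a) (aug_monomial_sym (partition_of xs)) \<alpha> =
    aug_monomial_sym (partition_of (a # xs)) \<alpha> +
    (\<Sum>j<length xs. aug_monomial_sym (partition_of (xs[j := xs ! j + a])) \<alpha>)"
proof -
  let ?T = "exponents \<alpha>" and ?X = "mset xs"
  let ?M = "\<lambda>Y. if ?T = Y then multiplicity_factorials Y else 0"
  let ?g = "\<lambda>e. if a \<le> e \<and> ?T - {#e#} + (if e = a then {#} else {#e - a#}) = ?X then multiplicity_factorials ?X else 0"
  have "series_mult (power_sum a) (aug_monomial_sym (partition_of xs)) \<alpha> =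
    (\<Sum>i | i \<in> supp \<alpha> \<and> a \<le> exponent \<alpha> i. aug_monomial_sym (partition_of xs) (\<alpha> - Poly_Mapping.single i a))"
    by (rule series_mult_power_sum[OF a])
  also have "\<dots> = (\<Sum>i | i \<in> supp \<alpha> \<and> a \<le> exponent \<alpha> i. ?g (exponent \<alpha> i))"
    using xs a by (intro sum.cong refl) (auto simp: aug_monomial_sym_eq exponents_minus_single)
  also have "\<dots> = (\<Sum>i\<in>supp \<alpha>. ?g (exponent \<alpha> i))"
    by (intro sum.mono_neutral_left) auto
  also have "\<dots> = (\<Sum>e\<in>#?T. ?g e)"
    unfolding sum_unfold_sum_mset
    by (subst (2) exponents_def) (simp only: image_mset.compositionality comp_def)
  also have "\<dots> = ?M (add_mset a ?X) + (\<Sum>b\<in>#?X. ?M (add_mset (b + a) (?X - {#b#})))"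
    by (rule multiset_aug_identity) (use a xs in auto)
  also have "(\<Sum>b\<in>#?X. ?M (add_mset (b + a) (?X - {#b#}))) = (\<Sum>j<length xs. ?M (mset (xs[j := xs ! j + a])))"
    by (rule sum_updates_eq_sum_mset[symmetric])
  also have "?M (add_mset a ?X) = aug_monomial_sym (partition_of (a # xs)) \<alpha>"
    using a xs by (simp add: aug_monomial_sym_eq)
  also have "(\<Sum>j<length xs. ?M (mset (xs[j := xs ! j + a]))) =
      (\<Sum>j<length xs. aug_monomial_sym (partition_of (xs[j := xs ! j + a])) \<alpha>)"
    unfolding aug_monomial_sym_eq parts_partition_of[OF positive_list_update[OF a xs]] ..
  finally show ?thesis .
qed

section \<open>Algebra homomorphisms on augmented monomials\<close>

lemma symmetric_sum:
  assumes "finite J" "\<And>j. j \<in> J \<Longrightarrow> f j \<in> symmetric_functions"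
  shows "(\<lambda>\<alpha>. \<Sum>j\<in>J. f j \<alpha>) \<in> symmetric_functions"
  using assms
proof (induction J)
  case empty
  then show ?case by (simp add: symmetric_functions_def)
next
  case (insert j J)
  then show ?case using series_add_symmetric[of "f j" "\<lambda>\<alpha>. \<Sum>j\<in>J. f j \<alpha>"]
    by (simp add: series_add_def)
qed

lemma symfun_alg_hom_sum:
  assumes \<phi>: "symfun_alg_hom \<phi>" and "finite J" "\<And>j. j \<in> J \<Longrightarrow> f j \<in> symmetric_functions"
  shows "\<phi> (\<lambda>\<alpha>. \<Sum>j\<in>J. f j \<alpha>) = (\<Sum>j\<in>J. \<phi> (f j))"
  using assms(2,3)
proof (induction J)
  case empty
  have "\<phi> (series_scale 0 series_one) = 0"
    using \<phi> series_one_symmetric by (simp add: symfun_alg_hom_def)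
  then show ?case by (simp add: series_scale_def)
next
  case (insert j J)
  then have "\<phi> (series_add (f j) (\<lambda>\<alpha>. \<Sum>j\<in>J. f j \<alpha>)) = \<phi> (f j) + (\<Sum>j\<in>J. \<phi> (f j))"
    using \<phi> symmetric_sum[of J f] by (simp add: symfun_alg_hom_def)
  then show ?case using insert by (simp add: series_add_def)
qed

text \<open>A homomorphism turns the product rule into the recursion of \<open>aug_poly\<close>. Its
  values on augmented monomials are thus determined by those on power sums.\<close>

lemma symfun_alg_hom_aug:
  assumes \<phi>: "symfun_alg_hom \<phi>"
  shows "0 \<notin> set xs \<Longrightarrow> \<phi> (aug_monomial_sym (partition_of xs)) = aug_poly (\<lambda>k. \<phi> (power_sum k)) xs"
proof (induction xs rule: length_induct)
  case (1 xs)
  show ?case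
  proof (cases xs)
    case Nil
    have "aug_monomial_sym (partition_of []) = series_one"
      by (auto simp: aug_monomial_sym_eq series_one_def exponents_def mset_set_empty_iff
          multiplicity_factorials_def fun_eq_iff)
    then show ?thesis using \<phi> Nil by (simp add: symfun_alg_hom_def)
  next
    case (Cons a ys)
    then have a: "a > 0" "0 \<notin> set ys" using 1 by auto
    let ?m = "\<lambda>xs. aug_monomial_sym (partition_of xs)"
    let ?S = "\<lambda>\<alpha>. \<Sum>j<length ys. ?m (ys[j := ys ! j + a]) \<alpha>"
    have S: "?S \<in> symmetric_functions"
      by (intro symmetric_sum aug_monomial_sym_symmetric) auto
    have "series_mult (power_sum a) (?m ys) = series_add (?m xs) ?S"
      using series_mult_power_sum_aug[OF a] Cons by (simp add: series_add_def fun_eq_iff)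
    moreover have "\<phi> (series_mult (power_sum a) (?m ys)) = \<phi> (power_sum a) * \<phi> (?m ys)"
      using \<phi> a(1) aug_monomial_sym_symmetric power_sum_symmetric by (simp add: symfun_alg_hom_def)
    moreover have "\<phi> (series_add (?m xs) ?S) = \<phi> (?m xs) + \<phi> ?S"
      using \<phi> S aug_monomial_sym_symmetric by (simp add: symfun_alg_hom_def)
    moreover have "\<phi> ?S = (\<Sum>j<length ys. \<phi> (?m (ys[j := ys ! j + a])))"
      by (intro symfun_alg_hom_sum \<phi> aug_monomial_sym_symmetric) auto
    ultimately show ?thesis
      using 1 Cons a positive_list_update[OF a] by simp
  qed
qed

section \<open>Evaluation at points of finite support\<close>

definition eval_monomial :: "(nat \<Rightarrow> real) \<Rightarrow> monomial \<Rightarrow> real" where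
  "eval_monomial x \<alpha> = (\<Prod>i\<in>supp \<alpha>. x i ^ exponent \<alpha> i)"

text \<open>\<open>Sum_any\<close> adds the nonzero terms if they are finitely many, as for
  symmetric \<open>f\<close> and \<open>x\<close> of finite support, and is 0 otherwise.\<close>

definition eval_series :: "(nat \<Rightarrow> real) \<Rightarrow> series \<Rightarrow> real" where
  "eval_series x f = Sum_any (\<lambda>\<alpha>. f \<alpha> * eval_monomial x \<alpha>)"

lemma eval_monomial_superset:
  "finite S \<Longrightarrow> supp \<alpha> \<subseteq> S \<Longrightarrow> eval_monomial x \<alpha> = (\<Prod>i\<in>S. x i ^ exponent \<alpha> i)"
  unfolding eval_monomial_def by (intro prod.mono_neutral_left) (auto simp: in_keys_iff)

lemma eval_monomial_add: "eval_monomial x (\<alpha> + \<beta>) = eval_monomial x \<alpha> * eval_monomial x \<beta>"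
proof -
  let ?S = "supp \<alpha> \<union> supp \<beta>"
  have "supp (\<alpha> + \<beta>) \<subseteq> ?S" by (rule Poly_Mapping.keys_add)
  then show ?thesis
    by (simp add: eval_monomial_superset[of ?S] lookup_add power_add prod.distrib)
qed

lemma finite_eval_support:
  assumes f: "f \<in> symmetric_functions" and x: "finite {i. x i \<noteq> 0}"
  shows "finite {\<alpha>. f \<alpha> * eval_monomial x \<alpha> \<noteq> 0}"
proof -
  obtain d where d: "\<forall>\<alpha>. f \<alpha> \<noteq> 0 \<longrightarrow> mdegree \<alpha> \<le> d"
    using f by (auto simp: symmetric_functions_def)
  have "supp \<alpha> \<subseteq> {i. x i \<noteq> 0}" if "eval_monomial x \<alpha> \<noteq> 0" for \<alpha>
    using that by (auto simp: eval_monomial_def prod_zero_iff in_keys_iff)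
  then have "{\<alpha>. f \<alpha> * eval_monomial x \<alpha> \<noteq> 0} \<subseteq> {\<alpha>. supp \<alpha> \<subseteq> {i. x i \<noteq> 0} \<and> mdegree \<alpha> \<le> d}"
    using d by auto
  then show ?thesis by (rule finite_subset) (rule finite_bounded_monomials[OF x])
qed

text \<open>The product of two finite sums, regrouped according to the monomial \<beta> +
  \<gamma>.\<close>

lemma eval_series_mult:
  assumes f: "f \<in> symmetric_functions" and g: "g \<in> symmetric_functions" and x: "finite {i. x i \<noteq> 0}"
  shows "eval_series x (series_mult f g) = eval_series x f * eval_series x g"
proof -
  let ?e = "eval_monomial x"
  let ?A = "{\<alpha>. f \<alpha> * ?e \<alpha> \<noteq> 0}" and ?B = "{\<alpha>. g \<alpha> * ?e \<alpha> \<noteq> 0}"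
  let ?h = "\<lambda>(\<beta>, \<gamma>). f \<beta> * g \<gamma> * ?e (\<beta> + \<gamma>)"
  have fin: "finite ?A" "finite ?B" using finite_eval_support f g x by blast+
  have h0: "z \<in> ?A \<times> ?B" if "?h z \<noteq> 0" for z
    using that by (cases z) (auto simp: eval_monomial_add)
  let ?C = "(\<lambda>(\<beta>, \<gamma>). \<beta> + \<gamma>) ` (?A \<times> ?B)"
  have inner: "series_mult f g \<alpha> * ?e \<alpha> = (\<Sum>z | z \<in> ?A \<times> ?B \<and> (\<lambda>(\<beta>, \<gamma>). \<beta> + \<gamma>) z = \<alpha>. ?h z)" for \<alpha>
  proof -
    have "series_mult f g \<alpha> * ?e \<alpha> = (\<Sum>z\<in>{(\<beta>, \<gamma>). \<beta> + \<gamma> = \<alpha>}. ?h z)"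
      unfolding series_mult_def sum_distrib_right by (intro sum.cong) auto
    also have "\<dots> = (\<Sum>z | z \<in> ?A \<times> ?B \<and> (\<lambda>(\<beta>, \<gamma>). \<beta> + \<gamma>) z = \<alpha>. ?h z)"
      using h0 by (intro sum.mono_neutral_right finite_monomial_splittings) auto
    finally show ?thesis .
  qed
  have "eval_series x (series_mult f g) = (\<Sum>\<alpha>\<in>?C. series_mult f g \<alpha> * ?e \<alpha>)"
    unfolding eval_series_def
  proof (rule Sum_any.expand_superset)
    show "finite ?C" using fin by blast
    show "{\<alpha>. series_mult f g \<alpha> * ?e \<alpha> \<noteq> 0} \<subseteq> ?C"
    proof (rule subsetI, rule ccontr)
      fix \<alpha> assume \<alpha>: "\<alpha> \<in> {\<alpha>. series_mult f g \<alpha> * ?e \<alpha> \<noteq> 0}" "\<alpha> \<notin> ?C"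
      then have "{z. z \<in> ?A \<times> ?B \<and> (\<lambda>(\<beta>, \<gamma>). \<beta> + \<gamma>) z = \<alpha>} = {}" by blast
      then have "series_mult f g \<alpha> * ?e \<alpha> = 0" by (simp only: inner sum.empty)
      with \<alpha> show False by simp
    qed
  qed
  also have "\<dots> = (\<Sum>z\<in>?A \<times> ?B. ?h z)"
    unfolding inner using fin by (intro sum.image_gen[symmetric]) blast
  also have "\<dots> = (\<Sum>\<beta>\<in>?A. f \<beta> * ?e \<beta>) * (\<Sum>\<gamma>\<in>?B. g \<gamma> * ?e \<gamma>)"
    unfolding sum_product sum.cartesian_product
    by (intro sum.cong) (auto simp: eval_monomial_add)
  also have "\<dots> = eval_series x f * eval_series x g"
    by (simp add: eval_series_def Sum_any.expand_set)
  finally show ?thesis .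
qed

lemma symfun_alg_hom_eval_series:
  assumes x: "finite {i. x i \<noteq> 0}"
  shows "symfun_alg_hom (eval_series x)"
  unfolding symfun_alg_hom_def
proof (intro conjI ballI allI)
  have "eval_series x series_one = (\<Sum>\<alpha>\<in>{0}. series_one \<alpha> * eval_monomial x \<alpha>)"
    unfolding eval_series_def by (rule Sum_any.expand_superset) (auto simp: series_one_def)
  then show "eval_series x series_one = 1" by (simp add: series_one_def eval_monomial_def)
next
  fix f g assume fg: "f \<in> symmetric_functions" "g \<in> symmetric_functions"
  then show "eval_series x (series_mult f g) = eval_series x f * eval_series x g"
    using x by (rule eval_series_mult)
  show "eval_series x (series_add f g) = eval_series x f + eval_series x g"
    using Sum_any.distrib[OF finite_eval_support finite_eval_support, OF fg(1) x fg(2) x]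
    by (simp add: eval_series_def series_add_def distrib_right)
next
  fix f c assume f: "f \<in> symmetric_functions"
  show "eval_series x (series_scale c f) = c * eval_series x f"
    using Sum_any_right_distrib[OF finite_eval_support[OF f x], of c]
    by (simp add: eval_series_def series_scale_def mult.assoc)
qed

lemma eval_power_sum:
  assumes k: "k > 0" and x: "finite I" "\<And>i. i \<notin> I \<Longrightarrow> x i = 0"
  shows "eval_series x (power_sum k) = (\<Sum>i\<in>I. x i ^ k)"
proof -
  have e: "eval_monomial x (Poly_Mapping.single i k) = x i ^ k" for i
    using k by (simp add: eval_monomial_def)
  have inj: "inj_on (\<lambda>i. Poly_Mapping.single i k) I"
  proof (rule inj_onI)
    fix i j assume "Poly_Mapping.single i k = Poly_Mapping.single j k"
    then have "supp (Poly_Mapping.single i k) = supp (Poly_Mapping.single j k)" by simp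
    then show "i = j" using k by simp
  qed
  have "eval_series x (power_sum k) = (\<Sum>\<alpha>\<in>(\<lambda>i. Poly_Mapping.single i k) ` I. power_sum k \<alpha> * eval_monomial x \<alpha>)"
    unfolding eval_series_def
  proof (rule Sum_any.expand_superset)
    show "{\<alpha>. power_sum k \<alpha> * eval_monomial x \<alpha> \<noteq> 0} \<subseteq> (\<lambda>i. Poly_Mapping.single i k) ` I"
    proof
      fix \<alpha> assume \<alpha>: "\<alpha> \<in> {\<alpha>. power_sum k \<alpha> * eval_monomial x \<alpha> \<noteq> 0}"
      then obtain i where i: "\<alpha> = Poly_Mapping.single i k" by (auto simp: power_sum_def split: if_splits)
      with \<alpha> k have "x i \<noteq> 0" by (auto simp: e)
      with x i show "\<alpha> \<in> (\<lambda>i. Poly_Mapping.single i k) ` I" by blast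
    qed
  qed (use x in auto)
  also have "\<dots> = (\<Sum>i\<in>I. x i ^ k)"
    unfolding sum.reindex[OF inj] by (intro sum.cong) (auto simp: power_sum_def e)
  finally show ?thesis .
qed

lemma symmetric_function_expansion:
  assumes f: "f \<in> symmetric_functions"
  obtains J c where "finite J" "f = (\<lambda>\<alpha>. \<Sum>\<mu>\<in>J. series_scale (c \<mu>) (aug_monomial_sym \<mu>) \<alpha>)"
proof -
  obtain d where d: "\<forall>\<alpha>. f \<alpha> \<noteq> 0 \<longrightarrow> mdegree \<alpha> \<le> d"
    using f by (auto simp: symmetric_functions_def)
  define J where "J = {\<mu>. psize \<mu> \<le> d}"
  \<comment> \<open>Any monomial of type \<mu> may be chosen, because the coefficient of
    \<open>f\<close> depends only on the type.\<close>
  define c where "c \<mu> = f (SOME \<alpha>. exponents \<alpha> = parts \<mu>) / multiplicity_factorials (parts \<mu>)" for \<mu>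
  have "f \<alpha> = (\<Sum>\<mu>\<in>J. series_scale (c \<mu>) (aug_monomial_sym \<mu>) \<alpha>)" for \<alpha>
  proof -
    let ?\<mu> = "Partition (exponents \<alpha>)"
    have p: "parts ?\<mu> = exponents \<alpha>" by (simp add: Partition_inverse)
    have nz: "multiplicity_factorials X \<noteq> 0" for X using multiplicity_factorials_pos[of X] by linarith
    have "exponents (SOME \<beta>. exponents \<beta> = parts ?\<mu>) = parts ?\<mu>"
      by (rule someI[of _ \<alpha>]) (simp add: p)
    then have "f (SOME \<beta>. exponents \<beta> = parts ?\<mu>) = f \<alpha>"
      by (intro symmetric_function_cong[OF f]) (simp add: p)
    then have same: "series_scale (c ?\<mu>) (aug_monomial_sym ?\<mu>) \<alpha> = f \<alpha>"
      using nz by (simp add: c_def series_scale_def aug_monomial_sym_eq p)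
    have other: "series_scale (c \<mu>) (aug_monomial_sym \<mu>) \<alpha> = 0" if "\<mu> \<noteq> ?\<mu>" for \<mu>
      using that by (auto simp: series_scale_def aug_monomial_sym_eq parts_inverse)
    have "(\<Sum>\<mu>\<in>J. series_scale (c \<mu>) (aug_monomial_sym \<mu>) \<alpha>) =
        (\<Sum>\<mu>\<in>J. if \<mu> = ?\<mu> then f \<alpha> else 0)"
      using same other by (intro sum.cong refl) auto
    also have "\<dots> = (if ?\<mu> \<in> J then f \<alpha> else 0)"
      using finite_psize_le[of d] by (simp add: J_def)
    also have "\<dots> = f \<alpha>" using d by (auto simp: J_def psize_def p mdegree_eq)
    finally show ?thesis by simp
  qed
  moreover have "finite J" unfolding J_def by (rule finite_psize_le)
  ultimately show thesis by (intro that[of J c]) auto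
qed

text \<open>The power sums are free generators, but it is easier to obtain the homomorphism as a
  limit of evaluations at points of finite support whose coordinates sum to \<open>1\<close>.\<close>

lemma chi_exists:
  assumes p: "p \<in> nabla_infty"
  shows "\<exists>\<phi>. symfun_alg_hom \<phi> \<and> \<phi> (power_sum 1) = 1 \<and> (\<forall>k\<ge>2. \<phi> (power_sum k) = suminf (\<lambda>i. p i ^ k))"
proof -
  obtain \<rho> where \<rho>: "\<And>N. psize (\<rho> N) = N" and lim: "(\<lambda>N. scaled (\<rho> N)) \<longlonglongrightarrow> p"
    using exists_approximating_partitions[OF p] by blast
  \<comment> \<open>The shift by one avoids the empty partition, at which the first power sum would
    evaluate to 0 instead of 1.\<close>
  define E where "E N = eval_series (scaled (\<rho> (Suc N)))" for N
  have lim': "(\<lambda>N. scaled (\<rho> (Suc N))) \<longlonglongrightarrow> p"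
    using lim by (rule LIMSEQ_Suc)
  have fin: "finite {i. scaled \<rho> i \<noteq> 0}" for \<rho>
    by (rule finite_subset[of _ "{..<length (part_list \<rho>)}"]) (auto simp: scaled_def nth_part_eq split: if_splits)
  have hom: "symfun_alg_hom (E N)" for N
    unfolding E_def by (intro symfun_alg_hom_eval_series fin)
  have E_p: "E N (power_sum k) = power_sums (scaled (\<rho> (Suc N))) k" if k: "k > 0" for N k
  proof -
    have "E N (power_sum k) = (\<Sum>i<length (part_list (\<rho> (Suc N))). scaled (\<rho> (Suc N)) i ^ k)"
      unfolding E_def by (rule eval_power_sum[OF k]) (auto simp: scaled_def nth_part_eq)
    then show ?thesis using k by (simp add: power_sums_scaled \<rho>)
  qed
  have conv_aug: "convergent (\<lambda>N. E N (aug_monomial_sym \<mu>))" for \<mu>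
  proof -
    let ?xs = "part_list \<mu>"
    have "E N (aug_monomial_sym \<mu>) = aug_poly (power_sums (scaled (\<rho> (Suc N)))) ?xs" for N
      using symfun_alg_hom_aug[OF hom, of ?xs N] E_p
      by (simp add: aug_poly_cong[of "\<lambda>k. E N (power_sum k)" "power_sums (scaled (\<rho> (Suc N)))"])
    moreover have "(\<lambda>N. aug_poly (power_sums (scaled (\<rho> (Suc N)))) ?xs) \<longlonglongrightarrow> aug_poly (power_sums p) ?xs"
      using continuous_on_tendsto_compose[OF continuous_on_aug_poly lim' p] scaled_in_nabla by simp
    ultimately show ?thesis by (auto simp: convergent_def)
  qed
  \<comment> \<open>Convergence on augmented monomials suffices, since they span the symmetric
    functions.\<close>
  have conv: "convergent (\<lambda>N. E N f)" if f: "f \<in> symmetric_functions" for f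
  proof -
    obtain J c where J: "finite J" "f = (\<lambda>\<alpha>. \<Sum>\<mu>\<in>J. series_scale (c \<mu>) (aug_monomial_sym \<mu>) \<alpha>)"
      using symmetric_function_expansion[OF f] .
    have "E N f = (\<Sum>\<mu>\<in>J. c \<mu> * E N (aug_monomial_sym \<mu>))" for N
      using J hom[of N] aug_monomial_sym_symmetric
      by (subst J(2), subst symfun_alg_hom_sum[OF hom J(1)])
        (auto simp: symfun_alg_hom_def intro!: series_scale_symmetric)
    then show ?thesis
      by (simp only:) (intro convergent_sum conv_aug convergent_const convergent_mult)
  qed
  define \<phi> where "\<phi> f = lim (\<lambda>N. E N f)" for f
  have L: "(\<lambda>N. E N f) \<longlonglongrightarrow> \<phi> f" if "f \<in> symmetric_functions" for f
    using conv[OF that] by (simp add: \<phi>_def convergent_LIMSEQ_iff)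
  have "symfun_alg_hom \<phi>"
    unfolding symfun_alg_hom_def
  proof (intro conjI ballI allI)
    show "\<phi> series_one = 1" using hom by (simp add: \<phi>_def symfun_alg_hom_def)
  next
    fix f g assume fg: "f \<in> symmetric_functions" "g \<in> symmetric_functions"
    have "(\<lambda>N. E N f + E N g) \<longlonglongrightarrow> \<phi> f + \<phi> g" "(\<lambda>N. E N f * E N g) \<longlonglongrightarrow> \<phi> f * \<phi> g"
      using fg by (intro tendsto_intros L; simp)+
    then show "\<phi> (series_add f g) = \<phi> f + \<phi> g" "\<phi> (series_mult f g) = \<phi> f * \<phi> g"
      using hom fg unfolding \<phi>_def[of "series_add f g"] \<phi>_def[of "series_mult f g"]
      by (auto simp: symfun_alg_hom_def limI)
  next
    fix f c assume f: "f \<in> symmetric_functions"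
    have "(\<lambda>N. c * E N f) \<longlonglongrightarrow> c * \<phi> f" using f by (intro tendsto_intros L)
    then show "\<phi> (series_scale c f) = c * \<phi> f"
      using hom f unfolding \<phi>_def[of "series_scale c f"] by (auto simp: symfun_alg_hom_def limI)
  qed
  moreover have ps: "\<phi> (power_sum k) = power_sums p k" if "k > 0" for k
    unfolding \<phi>_def E_p[OF that]
    using continuous_on_tendsto_compose[OF continuous_on_power_sums[OF that] lim' p] scaled_in_nabla
    by (intro limI) simp
  ultimately show ?thesis by (intro exI[of _ \<phi>]) (simp add: power_sums_def)
qed

text \<open>Existence makes the conditions on the chosen \<open>chi p\<close> available, and they
  fix its values here whichever homomorphism was chosen.\<close>

lemma chi_aug_monomial_sym:
  assumes p: "p \<in> nabla_infty" and xs: "0 \<notin> set xs"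
  shows "chi p (aug_monomial_sym (partition_of xs)) = aug_poly (power_sums p) xs"
proof -
  have *: "symfun_alg_hom (chi p) \<and> chi p (power_sum 1) = 1 \<and>
      (\<forall>k\<ge>2. chi p (power_sum k) = suminf (\<lambda>i. p i ^ k))"
    unfolding chi_def by (rule someI_ex[OF chi_exists[OF p]])
  then have q: "chi p (power_sum k) = power_sums p k" if "k > 0" for k
    using that by (cases "k = 1") (auto simp: power_sums_def)
  have "aug_poly (\<lambda>k. chi p (power_sum k)) xs = aug_poly (power_sums p) xs"
    by (rule aug_poly_cong[OF q xs])
  then show ?thesis
    using symfun_alg_hom_aug[of "chi p" xs] * xs by simp
qed

section \<open>The path-forest graph\<close>

lemma chain_Suc_0: "chain (Suc 0) = single_vertex"
  by (simp add: chain_def)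

lemma chain_Suc: "k > 0 \<Longrightarrow> chain (Suc k) = Node {#chain k#}"
  by (cases k) (auto simp: chain_def)

lemma chain_inject: "j > 0 \<Longrightarrow> k > 0 \<Longrightarrow> chain j = chain k \<longleftrightarrow> j = k"
proof (induction j arbitrary: k)
  case (Suc j)
  show ?case
  proof (cases "j = 0 \<or> k = Suc 0")
    case True
    then show ?thesis using Suc.prems
      by (cases j; cases k; cases "k - 1") (auto simp: chain_Suc chain_Suc_0)
  next
    case False
    then obtain i where "k = Suc i" "i > 0" using Suc.prems by (cases k) auto
    then show ?thesis using Suc.IH[of i] False by (simp add: chain_Suc)
  qed
qed simp

lemma count_image_mset_inj:
  assumes "inj f" shows "count (image_mset f A) (f x) = count A x"
  by (induction A) (use assms in \<open>auto simp: inj_eq\<close>)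

lemma count_Sum_mset: "count (\<Sum>\<^sub># A) x = (\<Sum>B\<in>#A. count B x)"
  by (induction A) auto

lemma leaf_attachments_Node:
  "leaf_attachments (Node B) = add_mset (Node (add_mset single_vertex B))
     (\<Sum>b\<in>#B. image_mset (\<lambda>b'. Node (add_mset b' (B - {#b#}))) (leaf_attachments b))"
  by (simp add: image_mset.compositionality comp_def)

text \<open>A new leaf at a vertex that already has a child creates a branching, so only the
  attachment at the end gives a chain.\<close>

lemma count_leaf_attachments_chain:
  "k > 0 \<Longrightarrow> j > 0 \<Longrightarrow> count (leaf_attachments (chain k)) (chain j) = of_bool (j = Suc k)"
proof (induction k arbitrary: j)
  case (Suc k)
  show ?case
  proof (cases "k = 0")
    case True
    have "leaf_attachments (chain (Suc k)) = {#chain (Suc (Suc 0))#}"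
      using True by (simp add: chain_Suc_0 chain_Suc leaf_attachments_Node del: leaf_attachments.simps)
    then show ?thesis using True Suc.prems chain_inject[of "Suc (Suc 0)" j] by auto
  next
    case False
    have "leaf_attachments (chain (Suc k)) = add_mset (Node {#single_vertex, chain k#})
        (image_mset (\<lambda>b'. Node {#b'#}) (leaf_attachments (chain k)))"
      using False by (simp add: chain_Suc leaf_attachments_Node del: leaf_attachments.simps)
    moreover have "Node {#single_vertex, chain k#} \<noteq> chain j"
      by (cases "j - 1") (use Suc.prems in \<open>auto simp: chain_def\<close>)
    moreover have "count (image_mset (\<lambda>b'. Node {#b'#}) (leaf_attachments (chain k))) (chain j) = of_bool (j = Suc (Suc k))"
    proof (cases "j = 1")
      case True
      then have "chain j \<notin># image_mset (\<lambda>b'. Node {#b'#}) (leaf_attachments (chain k))"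
        by (auto simp: chain_Suc_0)
      then have "count (image_mset (\<lambda>b'. Node {#b'#}) (leaf_attachments (chain k))) (chain j) = 0"
        by (simp only: not_in_iff)
      then show ?thesis using True by simp
    next
      case j: False
      with Suc.prems obtain i where i: "j = Suc i" "i > 0" by (cases j) auto
      have "inj (\<lambda>b'. Node {#b'#})" by (auto simp: inj_def)
      then show ?thesis
        using i False Suc.IH[of i] by (simp add: chain_Suc count_image_mset_inj[of "\<lambda>b'. Node {#b'#}"])
    qed
    ultimately show ?thesis by simp
  qed
qed simp

text \<open>\<open>chain 0\<close> and \<open>chain 1\<close> are the same tree, so
  \<open>chain\<close> is inverted on positive lengths only.\<close>

lemma image_mset_chain_inject:
  assumes "0 \<notin># X" "0 \<notin># Y" "image_mset chain X = image_mset chain Y"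
  shows "X = Y"
proof -
  let ?d = "inv_into {0<..} chain"
  have inj: "inj_on chain {0<..}" by (auto simp: inj_on_def chain_inject)
  have "image_mset ?d (image_mset chain Z) = Z" if "0 \<notin># Z" for Z
  proof -
    have "image_mset ?d (image_mset chain Z) = image_mset (\<lambda>x. x) Z"
      unfolding image_mset.compositionality comp_def
    proof (rule image_mset_cong)
      fix x assume "x \<in># Z"
      then have "x \<in> {0<..}" using that by (cases x) auto
      then show "?d (chain x) = x" by (rule inv_into_f_f[OF inj])
    qed
    then show ?thesis by simp
  qed
  from this[OF assms(1)] this[OF assms(2)] show ?thesis unfolding assms(3) by (rule trans[OF sym])
qed

text \<open>A leaf at the root adds a part 1; inside a branch only the attachment at the end of the
  chain leads to a path forest. Equal parts are counted separately, which yields the multiplicities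
  of the edges.\<close>

lemma n_attach_pf_tree:
  "n_attach (pf_tree \<mu>) (pf_tree \<rho>) =
     of_bool (parts \<rho> = add_mset 1 (parts \<mu>)) +
     (\<Sum>k\<in>#parts \<mu>. of_bool (parts \<rho> = add_mset (Suc k) (parts \<mu> - {#k#})))"
proof -
  let ?B = "image_mset chain (parts \<mu>)"
  have 1: "Node (add_mset single_vertex ?B) = pf_tree \<rho> \<longleftrightarrow> parts \<rho> = add_mset 1 (parts \<mu>)"
  proof
    assume "Node (add_mset single_vertex ?B) = pf_tree \<rho>"
    then have "image_mset chain (parts \<rho>) = image_mset chain (add_mset 1 (parts \<mu>))"
      by (simp add: pf_tree_def chain_Suc_0)
    then show "parts \<rho> = add_mset 1 (parts \<mu>)" by (rule image_mset_chain_inject[rotated 2]) auto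
  qed (simp add: pf_tree_def chain_Suc_0)
  have 2: "count (image_mset (\<lambda>b'. Node (add_mset b' (?B - {#chain k#}))) (leaf_attachments (chain k))) (pf_tree \<rho>) =
      of_bool (parts \<rho> = add_mset (Suc k) (parts \<mu> - {#k#}))" if k: "k \<in># parts \<mu>" for k
  proof -
    let ?Y = "parts \<mu> - {#k#}"
    let ?f = "\<lambda>b'. Node (add_mset b' (image_mset chain ?Y))"
    have k0: "k > 0" using k by (cases k) auto
    have Y0: "0 \<notin># ?Y" using in_diffD[of 0 "parts \<mu>"] by auto
    have B: "?B - {#chain k#} = image_mset chain ?Y"
      using k by (simp add: image_mset_Diff)
    \<comment> \<open>If the target contains all the other chains, the enlarged branch has to be the
      one remaining chain; otherwise it cannot be reached.\<close>
    have "count (image_mset ?f (leaf_attachments (chain k))) (pf_tree \<rho>) = of_bool (parts \<rho> = add_mset (Suc k) ?Y)"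
    proof (cases "\<exists>j. parts \<rho> = add_mset j ?Y")
      case True
      then obtain j where j: "parts \<rho> = add_mset j ?Y" by blast
      then have j0: "j > 0" using zero_notin_parts[of \<rho>] by (cases j) auto
      have inj: "inj ?f" by (auto simp: inj_def)
      have "pf_tree \<rho> = ?f (chain j)" by (simp add: pf_tree_def j)
      then show ?thesis
        using count_leaf_attachments_chain[OF k0 j0] by (simp only: count_image_mset_inj[OF inj] j) simp
    next
      case False
      have "pf_tree \<rho> \<noteq> ?f b'" for b'
      proof
        assume eq: "pf_tree \<rho> = ?f b'"
        then have e: "image_mset chain (parts \<rho>) = add_mset b' (image_mset chain ?Y)" by (simp add: pf_tree_def)
        then have "b' \<in># image_mset chain (parts \<rho>)" by simp
        then obtain j where j: "j \<in># parts \<rho>" "b' = chain j" by auto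
        have "image_mset chain (parts \<rho> - {#j#}) = image_mset chain ?Y"
          using e j by (simp add: image_mset_Diff)
        then have "parts \<rho> - {#j#} = ?Y"
          using in_diffD[of 0 "parts \<rho>"] by (intro image_mset_chain_inject Y0) auto
        then show False using False j(1) by (metis insert_DiffM)
      qed
      then have "pf_tree \<rho> \<notin># image_mset ?f (leaf_attachments (chain k))" by auto
      then have "count (image_mset ?f (leaf_attachments (chain k))) (pf_tree \<rho>) = 0" by (simp only: not_in_iff)
      then show ?thesis using False by simp
    qed
    then show ?thesis unfolding B .
  qed
  have "n_attach (pf_tree \<mu>) (pf_tree \<rho>) = of_bool (Node (add_mset single_vertex ?B) = pf_tree \<rho>) +
     (\<Sum>k\<in>#parts \<mu>. count (image_mset (\<lambda>b'. Node (add_mset b' (?B - {#chain k#}))) (leaf_attachments (chain k))) (pf_tree \<rho>))"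
    unfolding n_attach_def pf_tree_def[of \<mu>] leaf_attachments_Node
    by (simp add: count_Sum_mset image_mset.compositionality comp_def)
  also have "(\<Sum>k\<in>#parts \<mu>. count (image_mset (\<lambda>b'. Node (add_mset b' (?B - {#chain k#}))) (leaf_attachments (chain k))) (pf_tree \<rho>)) =
     (\<Sum>k\<in>#parts \<mu>. of_bool (parts \<rho> = add_mset (Suc k) (parts \<mu> - {#k#})))"
    using 2 by (intro arg_cong[of _ _ sum_mset] image_mset_cong) auto
  finally show ?thesis by (simp only: 1)
qed

lemma n_attach_partition_of:
  assumes "0 \<notin> set xs"
  shows "n_attach (pf_tree (partition_of xs)) (pf_tree \<rho>) =
     of_bool (\<rho> = partition_of (1 # xs)) + (\<Sum>j<length xs. of_bool (\<rho> = partition_of (xs[j := xs ! j + 1])))"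
proof -
  have eq: "\<rho> = partition_of ys \<longleftrightarrow> parts \<rho> = mset ys" if "0 \<notin> set ys" for ys
    using partition_of_eq_iff[OF that, of \<rho>] by auto
  show ?thesis
    using assms positive_list_update[of 1 xs] sum_updates_eq_sum_mset[of "\<lambda>Y. of_bool (parts \<rho> = Y) :: nat" xs 1]
    by (simp add: n_attach_pf_tree eq)
qed

lemma sum_n_attach:
  assumes "0 \<notin> set xs"
  shows "(\<Sum>\<rho> | psize \<rho> = sum_list xs + 1. real (n_attach (pf_tree (partition_of xs)) (pf_tree \<rho>)) * h \<rho>) =
     h (partition_of (1 # xs)) + (\<Sum>j<length xs. h (partition_of (xs[j := xs ! j + 1])))"
proof -
  let ?L = "{\<rho>. psize \<rho> = sum_list xs + 1}"
  have pick: "(\<Sum>\<rho>\<in>?L. of_bool (\<rho> = \<kappa>) * h \<rho>) = h \<kappa>" if "psize \<kappa> = sum_list xs + 1" for \<kappa>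
  proof -
    have "(\<Sum>\<rho>\<in>?L. of_bool (\<rho> = \<kappa>) * h \<rho>) = (\<Sum>\<rho>\<in>?L. if \<rho> = \<kappa> then h \<rho> else 0)"
      by (intro sum.cong) auto
    also have "\<dots> = h \<kappa>" using that by simp
    finally show ?thesis .
  qed
  have "(\<Sum>\<rho>\<in>?L. real (n_attach (pf_tree (partition_of xs)) (pf_tree \<rho>)) * h \<rho>) =
      (\<Sum>\<rho>\<in>?L. of_bool (\<rho> = partition_of (1 # xs)) * h \<rho>) +
      (\<Sum>j<length xs. \<Sum>\<rho>\<in>?L. of_bool (\<rho> = partition_of (xs[j := xs ! j + 1])) * h \<rho>)"
    unfolding n_attach_partition_of[OF assms] of_nat_add of_nat_sum of_nat_of_bool distrib_right
      sum.distrib sum_distrib_right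
    by (subst (2) sum.swap) (rule refl)
  also have "\<dots> = h (partition_of (1 # xs)) + (\<Sum>j<length xs. h (partition_of (xs[j := xs ! j + 1])))"
  proof (intro arg_cong2[of _ _ _ _ "(+)"] sum.cong refl pick)
    fix j assume j: "j \<in> {..<length xs}"
    have "sum_list (xs[j := xs ! j + 1]) = sum_list xs + 1"
      using j member_le_sum_list[of "xs ! j" xs] by (simp add: sum_list_update)
    then show "psize (partition_of (xs[j := xs ! j + 1])) = sum_list xs + 1"
      using positive_list_update[of 1 xs j] assms by simp
  qed (use assms in simp)
  finally show ?thesis .
qed

text \<open>A step in the graph adds a part 1 or enlarges a part by 1, which is the right side of
  the product rule for \<open>a = 1\<close>.\<close>

lemma harmonic_iff:
  "harmonic h \<longleftrightarrow> (\<forall>\<mu>. h \<mu> \<ge> 0) \<and> (\<forall>xs. 0 \<notin> set xs \<longrightarrow>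
     h (partition_of xs) = h (partition_of (1 # xs)) + (\<Sum>j<length xs. h (partition_of (xs[j := xs ! j + 1]))))"
proof -
  have all: "(\<forall>\<mu>. P \<mu>) \<longleftrightarrow> (\<forall>xs. 0 \<notin> set xs \<longrightarrow> P (partition_of xs))" for P
    by (metis partition_of_part_list zero_notin_part_list)
  have "(\<forall>\<mu>. h \<mu> = (\<Sum>\<rho> | psize \<rho> = psize \<mu> + 1. real (n_attach (pf_tree \<mu>) (pf_tree \<rho>)) * h \<rho>)) \<longleftrightarrow>
    (\<forall>xs. 0 \<notin> set xs \<longrightarrow> h (partition_of xs) =
      (\<Sum>\<rho> | psize \<rho> = psize (partition_of xs) + 1. real (n_attach (pf_tree (partition_of xs)) (pf_tree \<rho>)) * h \<rho>))"
    by (rule all)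
  also have "\<dots> \<longleftrightarrow> (\<forall>xs. 0 \<notin> set xs \<longrightarrow>
     h (partition_of xs) = h (partition_of (1 # xs)) + (\<Sum>j<length xs. h (partition_of (xs[j := xs ! j + 1]))))"
    by (intro all_cong1 imp_cong refl) (simp only: psize_partition_of sum_n_attach not_False_eq_True)
  finally show ?thesis unfolding harmonic_def by (rule arg_cong)
qed

section \<open>Counting paths\<close>

lemma n_attach_pos_psize:
  assumes "n_attach (pf_tree \<mu>) (pf_tree \<rho>) > 0"
  shows "psize \<rho> = psize \<mu> + 1"
proof -
  have "parts \<rho> = add_mset 1 (parts \<mu>) \<or> (\<exists>k\<in>#parts \<mu>. parts \<rho> = add_mset (Suc k) (parts \<mu> - {#k#}))"
  proof (rule ccontr)
    assume "\<not> ?thesis"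
    then have "n_attach (pf_tree \<mu>) (pf_tree \<rho>) = 0" by (simp add: n_attach_pf_tree)
    with assms show False by simp
  qed
  then show ?thesis
  proof
    assume "\<exists>k\<in>#parts \<mu>. parts \<rho> = add_mset (Suc k) (parts \<mu> - {#k#})"
    then obtain k Y where "parts \<mu> = add_mset k Y" "parts \<rho> = add_mset (Suc k) (parts \<mu> - {#k#})"
      by (metis multi_member_split)
    then show ?thesis by (simp add: psize_def)
  qed (simp add: psize_def)
qed

lemma pf_path_psize: "pf_path \<mu> es \<rho> \<Longrightarrow> psize \<rho> = psize \<mu> + length es"
proof (induction es arbitrary: \<mu>)
  case (Cons e es)
  obtain \<nu> i \<kappa> where e: "e = (\<nu>, i, \<kappa>)" by (cases e)
  then have "psize \<kappa> = psize \<mu> + 1" "pf_path \<kappa> es \<rho>"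
    using Cons.prems n_attach_pos_psize[of \<mu> \<kappa>] by auto
  then show ?case using Cons.IH by simp
qed simp

lemma pf_paths_step:
  assumes "psize \<mu> < psize \<rho>"
  shows "{es. pf_path \<mu> es \<rho>} = (\<lambda>(\<kappa>, i, es). (\<mu>, i, \<kappa>) # es) `
    (SIGMA \<kappa>:{\<kappa>. psize \<kappa> = psize \<mu> + 1}. {..<n_attach (pf_tree \<mu>) (pf_tree \<kappa>)} \<times> {es. pf_path \<kappa> es \<rho>})"
    (is "_ = ?f ` ?S")
proof (intro equalityI subsetI)
  fix es assume es: "es \<in> {es. pf_path \<mu> es \<rho>}"
  then have "es \<noteq> []" using assms by auto
  then obtain \<nu> i \<kappa> es' where "es = (\<nu>, i, \<kappa>) # es'" by (metis list.exhaust prod_cases3)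
  then show "es \<in> ?f ` ?S"
    using es n_attach_pos_psize[of \<mu> \<kappa>] by (intro image_eqI[of _ _ "(\<kappa>, i, es')"]) auto
qed auto

lemma finite_pf_paths: "finite {es. pf_path \<mu> es \<rho>}"
proof (induction "psize \<rho> - psize \<mu>" arbitrary: \<mu> rule: less_induct)
  case less
  show ?case
  proof (cases "psize \<mu> < psize \<rho>")
    case True
    then show ?thesis unfolding pf_paths_step[OF True]
      by (intro finite_imageI finite_SigmaI finite_cartesian_product less.hyps) auto
  next
    case False
    then have "{es. pf_path \<mu> es \<rho>} \<subseteq> {[]}" by (auto dest: pf_path_psize)
    then show ?thesis by (rule finite_subset) simp
  qed
qed

lemma n_pf_same_level:
  assumes "psize \<mu> = psize \<rho>" shows "n_pf \<mu> \<rho> = of_bool (\<mu> = \<rho>)"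
proof -
  have "{es. pf_path \<mu> es \<rho>} = (if \<mu> = \<rho> then {[]} else {})"
    using assms by (auto dest: pf_path_psize) (use pf_path_psize in fastforce)
  then show ?thesis by (simp add: n_pf_def)
qed

lemma n_pf_step:
  assumes "psize \<mu> < psize \<rho>"
  shows "n_pf \<mu> \<rho> = (\<Sum>\<kappa> | psize \<kappa> = psize \<mu> + 1. n_attach (pf_tree \<mu>) (pf_tree \<kappa>) * n_pf \<kappa> \<rho>)"
proof -
  have "n_pf \<mu> \<rho> = card (SIGMA \<kappa>:{\<kappa>. psize \<kappa> = psize \<mu> + 1}.
      {..<n_attach (pf_tree \<mu>) (pf_tree \<kappa>)} \<times> {es. pf_path \<kappa> es \<rho>})"
    unfolding n_pf_def pf_paths_step[OF assms] by (intro card_image) (auto simp: inj_on_def)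
  also have "\<dots> = (\<Sum>\<kappa> | psize \<kappa> = psize \<mu> + 1. n_attach (pf_tree \<mu>) (pf_tree \<kappa>) * n_pf \<kappa> \<rho>)"
    by (subst card_SigmaI) (auto simp: finite_pf_paths card_cartesian_product n_pf_def)
  finally show ?thesis .
qed

text \<open>Iterates the one-step relation up to level \<open>N\<close>. The relation is assumed
  below \<open>N\<close> only, so that this also covers functions attached to a fixed partition of
  \<open>N\<close>.\<close>

lemma n_pf_expand:
  assumes g: "\<And>\<mu>. psize \<mu> < N \<Longrightarrow>
    g \<mu> = (\<Sum>\<kappa> | psize \<kappa> = psize \<mu> + 1. real (n_attach (pf_tree \<mu>) (pf_tree \<kappa>)) * g \<kappa>)"
    and "psize \<mu> \<le> N"
  shows "g \<mu> = (\<Sum>\<nu> | psize \<nu> = N. real (n_pf \<mu> \<nu>) * g \<nu>)"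
  using assms(2)
proof (induction "N - psize \<mu>" arbitrary: \<mu> rule: less_induct)
  case less
  show ?case
  proof (cases "psize \<mu> = N")
    case True
    have "(\<Sum>\<nu> | psize \<nu> = N. real (n_pf \<mu> \<nu>) * g \<nu>) = (\<Sum>\<nu> | psize \<nu> = N. if \<nu> = \<mu> then g \<nu> else 0)"
      using True by (intro sum.cong) (auto simp: n_pf_same_level)
    then show ?thesis using True by simp
  next
    case False
    with less.prems have lt: "psize \<mu> < N" by simp
    have "g \<mu> = (\<Sum>\<kappa> | psize \<kappa> = psize \<mu> + 1. real (n_attach (pf_tree \<mu>) (pf_tree \<kappa>)) *
        (\<Sum>\<nu> | psize \<nu> = N. real (n_pf \<kappa> \<nu>) * g \<nu>))"
      unfolding g[OF lt] using lt by (intro sum.cong refl arg_cong2[of _ _ _ _ "(*)"] less.hyps) auto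
    also have "\<dots> = (\<Sum>\<nu> | psize \<nu> = N. \<Sum>\<kappa> | psize \<kappa> = psize \<mu> + 1.
        real (n_attach (pf_tree \<mu>) (pf_tree \<kappa>)) * real (n_pf \<kappa> \<nu>) * g \<nu>)"
      unfolding sum_distrib_left by (subst sum.swap) (simp add: mult.assoc)
    also have "\<dots> = (\<Sum>\<nu> | psize \<nu> = N. real (n_pf \<mu> \<nu>) * g \<nu>)"
      using lt by (intro sum.cong refl) (simp add: n_pf_step sum_distrib_right)
    finally show ?thesis .
  qed
qed

section \<open>Asymptotics of the Martin kernel\<close>

text \<open>The falling factorial of \<open>v\<close> with every factor scaled by \<open>c\<close>:
  \<open>c = 1\<close> counts, while \<open>c = 1 / N\<close> is to be compared with powers of
  \<open>v / N\<close>. The subtraction is real, and a zero factor occurs once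
  \<open>b > v\<close>.\<close>

definition falling :: "real \<Rightarrow> nat \<Rightarrow> nat \<Rightarrow> real" where
  "falling c v b = (\<Prod>t<b. c * (real v - real t))"

lemma falling_0 [simp]: "falling c v 0 = 1"
  by (simp add: falling_def)

lemma falling_Suc: "falling c v (Suc b) = falling c v b * (c * (real v - real b))"
  by (simp add: falling_def)

lemma falling_eq_0: "v < b \<Longrightarrow> falling c v b = 0"
  by (auto simp: falling_def)

lemma falling_scale: "falling c v b = c ^ b * falling 1 v b"
  by (simp add: falling_def prod.distrib)

lemma falling_fact: "falling 1 (n + m) m * fact n = fact (n + m)"
proof (induction m arbitrary: n)
  case (Suc m)
  have "falling 1 (n + Suc m) (Suc m) * fact n = falling 1 (Suc n + m) m * fact (Suc n)"
    by (simp add: falling_Suc algebra_simps)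
  also have "\<dots> = fact (Suc n + m)" by (rule Suc)
  finally show ?case by simp
qed simp

text \<open>The error retains a factor \<open>v / N\<close>, so that summing over parts of total
  size at most \<open>N\<close> still leaves order \<open>1 / N\<close>.\<close>

lemma falling_bounds:
  assumes "v \<le> N" "b > 0" "N > 0"
  shows "0 \<le> falling (1 / real N) v b" "falling (1 / real N) v b \<le> real v / real N"
    "\<bar>falling (1 / real N) v b - (real v / real N) ^ b\<bar> \<le> (real b)\<^sup>2 * (real v / real N) / real N"
proof -
  let ?y = "real v / real N"
  have y: "0 \<le> ?y" "?y \<le> 1" using assms by auto
  have "0 \<le> falling (1 / real N) v b \<and> falling (1 / real N) v b \<le> ?y \<and>
    \<bar>falling (1 / real N) v b - ?y ^ b\<bar> \<le> (real b)\<^sup>2 * ?y / real N"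
    using assms(2)
  proof (induction b rule: nat_induct_non_zero)
    case 1
    then show ?case using y by (simp add: falling_def)
  next
    case (Suc b)
    let ?F = "falling (1 / real N) v b"
    let ?r = "1 / real N * (real v - real b)"
    have S: "falling (1 / real N) v (Suc b) = ?F * ?r" by (rule falling_Suc)
    have F: "0 \<le> ?F" "?F \<le> ?y" "\<bar>?F - ?y ^ b\<bar> \<le> (real b)\<^sup>2 * ?y / real N" using Suc.IH by auto
    have r: "?r = ?y - real b / real N" by (simp add: diff_divide_distrib)
    \<comment> \<open>If \<open>v < b\<close>, a zero factor has already occurred; otherwise the new
      factor lies between 0 and 1.\<close>
    have "0 \<le> ?F * ?r \<and> ?F * ?r \<le> ?y"
    proof (cases "v < b")
      case True
      then show ?thesis using y by (simp add: falling_eq_0)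
    next
      case False
      then have "real b / real N \<le> ?y" by (simp add: divide_right_mono)
      then have r01: "0 \<le> ?r" "?r \<le> 1"
        unfolding r using y divide_nonneg_nonneg[of "real b" "real N"] by linarith+
      have "0 \<le> ?F * ?r" using F(1) r01(1) by (rule mult_nonneg_nonneg)
      moreover have "?F * ?r \<le> ?F" using r01(2) F(1) by (intro mult_left_le)
      ultimately show ?thesis using F(2) by linarith
    qed
    moreover have "\<bar>?F * ?r - ?y ^ Suc b\<bar> \<le> (real (Suc b))\<^sup>2 * ?y / real N"
    proof -
      have "?F * ?r - ?y ^ Suc b = (?F - ?y ^ b) * ?y - ?F * (real b / real N)"
        unfolding r by (simp add: algebra_simps)
      then have "\<bar>?F * ?r - ?y ^ Suc b\<bar> \<le> \<bar>?F - ?y ^ b\<bar> * ?y + ?F * (real b / real N)"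
        using y F by (simp add: abs_mult abs_triangle_ineq4[THEN order_trans])
      also have "\<bar>?F - ?y ^ b\<bar> * ?y \<le> \<bar>?F - ?y ^ b\<bar> * 1" using y by (intro mult_left_mono) auto
      also have "\<bar>?F - ?y ^ b\<bar> * 1 \<le> (real b)\<^sup>2 * ?y / real N" using F by simp
      also have "?F * (real b / real N) \<le> ?y * (real b / real N)" using F by (intro mult_right_mono) auto
      also have "(real b)\<^sup>2 * ?y / real N + ?y * (real b / real N) = ((real b)\<^sup>2 + real b) * ?y / real N"
        by (simp add: add_divide_distrib algebra_simps)
      \<comment> \<open>Here \<open>b\<^sup>2 + b \<le> (b + 1)\<^sup>2\<close>, the origin of the
        quadratic constant.\<close>
      also have "\<dots> \<le> (real (Suc b))\<^sup>2 * ?y / real N"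
        using y by (intro divide_right_mono mult_right_mono) (auto simp: power2_eq_square algebra_simps)
      finally show ?thesis by simp
    qed
    ultimately show ?case unfolding S by blast
  qed
  then show "0 \<le> falling (1 / real N) v b" "falling (1 / real N) v b \<le> ?y"
    "\<bar>falling (1 / real N) v b - ?y ^ b\<bar> \<le> (real b)\<^sup>2 * ?y / real N" by auto
qed

lemma inj_sum_scale:
  fixes c :: "'b::comm_ring_1"
  assumes "\<And>b i. w' b i = c ^ b * w b i"
  shows "inj_sum w' xs I = c ^ sum_list xs * inj_sum w xs I"
  by (induction xs arbitrary: I) (simp_all add: assms power_add sum_distrib_left mult_ac)

text \<open>The weights are exchanged one entry at a time. Because the \<open>v i / N\<close> sum to
  at most 1, the errors at different indices only average, and each entry contributes its
  square.\<close>

lemma inj_sum_falling_approx: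
  assumes "finite I" "(\<Sum>i\<in>I. v i) \<le> N" "N > 0" "0 \<notin> set xs"
  defines "F \<equiv> inj_sum (\<lambda>b i. falling (1 / real N) (v i) b) xs I"
    and "P \<equiv> inj_sum (\<lambda>b i. (real (v i) / real N) ^ b) xs I"
  shows "0 \<le> F \<and> F \<le> 1 \<and> 0 \<le> P \<and> P \<le> 1 \<and> \<bar>F - P\<bar> \<le> (\<Sum>b\<leftarrow>xs. (real b)\<^sup>2) / real N"
  using assms(1,2,4) unfolding F_def P_def
proof (induction xs arbitrary: I)
  case (Cons b xs)
  let ?f = "\<lambda>i. falling (1 / real N) (v i) b" and ?p = "\<lambda>i. (real (v i) / real N) ^ b"
  let ?y = "\<lambda>i. real (v i) / real N"
  let ?F = "\<lambda>i. inj_sum (\<lambda>b i. falling (1 / real N) (v i) b) xs (I - {i})"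
  let ?P = "\<lambda>i. inj_sum (\<lambda>b i. (real (v i) / real N) ^ b) xs (I - {i})"
  let ?C = "\<Sum>b\<leftarrow>xs. (real b)\<^sup>2"
  have b: "b > 0" using Cons.prems by simp
  have C: "?C \<ge> 0" by (intro sum_list_nonneg) auto
  have IH: "0 \<le> ?F i \<and> ?F i \<le> 1 \<and> 0 \<le> ?P i \<and> ?P i \<le> 1 \<and> \<bar>?F i - ?P i\<bar> \<le> ?C / real N" if "i \<in> I" for i
  proof (rule Cons.IH)
    have "(\<Sum>i\<in>I - {i}. v i) \<le> (\<Sum>i\<in>I. v i)" using Cons.prems by (intro sum_mono2) auto
    then show "(\<Sum>i\<in>I - {i}. v i) \<le> N" using Cons.prems by simp
  qed (use Cons.prems in auto)
  have vN: "v i \<le> N" if "i \<in> I" for i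
    using member_le_sum[of i I v] Cons.prems that by simp
  have fb: "0 \<le> ?f i" "?f i \<le> ?y i" "\<bar>?f i - ?p i\<bar> \<le> (real b)\<^sup>2 * ?y i / real N" if "i \<in> I" for i
    using falling_bounds[OF vN[OF that] b assms(3)] by auto
  have pb: "0 \<le> ?p i" "?p i \<le> ?y i" if "i \<in> I" for i
  proof -
    have "?y i \<le> 1" using vN[OF that] assms(3) by simp
    then show "0 \<le> ?p i" "?p i \<le> ?y i" using power_decreasing[of 1 b "?y i"] b by auto
  qed
  have "(\<Sum>i\<in>I. ?y i) = real (\<Sum>i\<in>I. v i) / real N" by (simp add: sum_divide_distrib)
  then have Y: "(\<Sum>i\<in>I. ?y i) \<le> 1" using Cons.prems(2) assms(3) by (simp del: of_nat_sum)
  have le1: "(\<Sum>i\<in>I. g i * h i) \<le> 1" if "\<And>i. i \<in> I \<Longrightarrow> 0 \<le> g i \<and> g i \<le> ?y i \<and> 0 \<le> h i \<and> h i \<le> 1" for g h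
  proof -
    have "(\<Sum>i\<in>I. g i * h i) \<le> (\<Sum>i\<in>I. ?y i)"
      using that by (intro sum_mono) (meson mult_left_le order_trans)
    then show ?thesis using Y by simp
  qed
  have "\<bar>(\<Sum>i\<in>I. ?f i * ?F i) - (\<Sum>i\<in>I. ?p i * ?P i)\<bar> \<le> (\<Sum>i\<in>I. \<bar>?f i * ?F i - ?p i * ?P i\<bar>)"
    unfolding sum_subtractf[symmetric] by (rule sum_abs)
  also have "\<dots> \<le> (\<Sum>i\<in>I. ?y i * (((real b)\<^sup>2 + ?C) / real N))"
  proof (rule sum_mono)
    fix i assume i: "i \<in> I"
    have "?f i * ?F i - ?p i * ?P i = (?f i - ?p i) * ?F i + ?p i * (?F i - ?P i)"
      by (simp add: algebra_simps)
    then have "\<bar>?f i * ?F i - ?p i * ?P i\<bar> \<le> \<bar>?f i - ?p i\<bar> * ?F i + ?p i * \<bar>?F i - ?P i\<bar>"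
      using abs_triangle_ineq[of "(?f i - ?p i) * ?F i" "?p i * (?F i - ?P i)"] IH[OF i] pb(1)[OF i]
      unfolding abs_mult by simp
    also have "\<dots> \<le> \<bar>?f i - ?p i\<bar> * 1 + ?y i * (?C / real N)"
      using IH[OF i] pb[OF i] by (intro add_mono mult_mono) auto
    also have "\<dots> \<le> (real b)\<^sup>2 * ?y i / real N + ?y i * (?C / real N)"
      using fb[OF i] by simp
    also have "\<dots> = ?y i * (((real b)\<^sup>2 + ?C) / real N)"
      by (simp add: add_divide_distrib algebra_simps)
    finally show "\<bar>?f i * ?F i - ?p i * ?P i\<bar> \<le> ?y i * (((real b)\<^sup>2 + ?C) / real N)" .
  qed
  also have "\<dots> = (\<Sum>i\<in>I. ?y i) * (((real b)\<^sup>2 + ?C) / real N)" by (simp only: sum_distrib_right)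
  also have "\<dots> \<le> 1 * (((real b)\<^sup>2 + ?C) / real N)"
    using Y C by (intro mult_right_mono) auto
  finally have "\<bar>(\<Sum>i\<in>I. ?f i * ?F i) - (\<Sum>i\<in>I. ?p i * ?P i)\<bar> \<le> ((real b)\<^sup>2 + ?C) / real N" by simp
  moreover have "0 \<le> (\<Sum>i\<in>I. ?f i * ?F i)" "0 \<le> (\<Sum>i\<in>I. ?p i * ?P i)"
    using fb pb IH by (auto intro!: sum_nonneg mult_nonneg_nonneg)
  moreover have "(\<Sum>i\<in>I. ?f i * ?F i) \<le> 1" "(\<Sum>i\<in>I. ?p i * ?P i) \<le> 1"
    using fb pb IH by (auto intro!: le1)
  ultimately show ?case by simp
qed (use assms in simp)

text \<open>A nonzero term is an injection under which no entry exceeds the value at its image. If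
  the totals agree, entries and values coincide and all values outside the image are 0.\<close>

lemma inj_sum_falling_nonzero:
  assumes "finite I" "0 \<notin> set xs" "inj_sum (\<lambda>b i. falling 1 (v i) b) xs I \<noteq> 0"
  shows "sum_list xs \<le> (\<Sum>i\<in>I. v i) \<and>
    (sum_list xs = (\<Sum>i\<in>I. v i) \<longrightarrow> mset xs = filter_mset (\<lambda>x. x \<noteq> 0) (image_mset v (mset_set I)))"
  using assms
proof (induction xs arbitrary: I)
  case (Cons a xs)
  from Cons.prems(3) obtain i where i: "i \<in> I" "falling 1 (v i) a * inj_sum (\<lambda>b i. falling 1 (v i) b) xs (I - {i}) \<noteq> 0"
    by (auto elim: sum.not_neutral_contains_not_neutral)
  then have a: "a \<le> v i" using falling_eq_0[of "v i" a 1] by (cases "a \<le> v i") auto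
  have IH: "sum_list xs \<le> (\<Sum>i\<in>I - {i}. v i) \<and>
    (sum_list xs = (\<Sum>i\<in>I - {i}. v i) \<longrightarrow> mset xs = filter_mset (\<lambda>x. x \<noteq> 0) (image_mset v (mset_set (I - {i}))))"
    by (rule Cons.IH) (use Cons.prems i in auto)
  have S: "(\<Sum>i\<in>I. v i) = v i + (\<Sum>i\<in>I - {i}. v i)" using Cons.prems(1) i(1) by (rule sum.remove)
  have M: "mset_set I = add_mset i (mset_set (I - {i}))" using Cons.prems(1) i(1) by (rule mset_set.remove)
  show ?case
  proof (intro conjI impI)
    show "sum_list (a # xs) \<le> (\<Sum>i\<in>I. v i)" using S a IH by simp
  next
    assume "sum_list (a # xs) = (\<Sum>i\<in>I. v i)"
    then have "a = v i" "sum_list xs = (\<Sum>i\<in>I - {i}. v i)" using S a IH by auto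
    then show "mset (a # xs) = filter_mset (\<lambda>x. x \<noteq> 0) (image_mset v (mset_set I))"
      using IH Cons.prems(2) by (simp add: M)
  qed
qed auto

text \<open>Counts the ways to assign distinct parts of \<rho> to the parts of \<mu> and to choose,
  for each part \<open>b\<close>, an ordered \<open>b\<close>-tuple of distinct elements of its
  image.\<close>

definition falling_count :: "int_partition \<Rightarrow> int_partition \<Rightarrow> real" where
  "falling_count \<mu> \<rho> = inj_sum (\<lambda>b i. falling 1 (nth_part \<rho> i) b) (part_list \<mu>) {..<length (part_list \<rho>)}"

lemma falling_count_partition_of:
  "0 \<notin> set xs \<Longrightarrow> falling_count (partition_of xs) \<rho> =
     inj_sum (\<lambda>b i. falling 1 (nth_part \<rho> i) b) xs {..<length (part_list \<rho>)}"
  unfolding falling_count_def by (rule inj_sum_mset_cong) auto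

lemma falling_count_eq_0:
  assumes "psize \<nu> = psize \<rho>" "\<nu> \<noteq> \<rho>" shows "falling_count \<nu> \<rho> = 0"
proof (rule ccontr)
  assume "falling_count \<nu> \<rho> \<noteq> 0"
  then have "sum_list (part_list \<nu>) = (\<Sum>i<length (part_list \<rho>). nth_part \<rho> i) \<longrightarrow>
      mset (part_list \<nu>) = filter_mset (\<lambda>x. x \<noteq> 0) (image_mset (nth_part \<rho>) (mset_set {..<length (part_list \<rho>)}))"
    unfolding falling_count_def using inj_sum_falling_nonzero[of "{..<length (part_list \<rho>)}" "part_list \<nu>" "nth_part \<rho>"]
    by simp
  moreover have "filter_mset (\<lambda>x. x \<noteq> 0) (parts \<rho>) = parts \<rho>"
    unfolding filter_mset_eq_conv by (auto intro: gr0I)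
  ultimately have "parts \<nu> = parts \<rho>"
    using assms(1) by (simp add: sum_nth_part image_nth_part)
  with assms(2) show False by (simp add: parts_inject)
qed

text \<open>The two sides satisfy the same recursion in \<open>\<mu>\<close>, and on the level of \<open>\<rho>\<close> only
  \<open>\<mu> = \<rho>\<close> contributes.\<close>

lemma n_pf_falling_count:
  assumes "psize \<mu> \<le> psize \<rho>"
  shows "fact (psize \<rho> - psize \<mu>) * falling_count \<mu> \<rho> = real (n_pf \<mu> \<rho>) * falling_count \<rho> \<rho>"
proof -
  let ?N = "psize \<rho>" and ?I = "{..<length (part_list \<rho>)}"
  \<comment> \<open>The factorial absorbs the factor \<open>psize \<rho> - psize \<mu>\<close> of
    the product rule, so that \<open>g\<close> satisfies the one-step relation exactly.\<close>
  define g where "g \<mu> = fact (?N - psize \<mu>) * falling_count \<mu> \<rho>" for \<mu>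
  have "g \<mu> = (\<Sum>\<kappa> | psize \<kappa> = psize \<mu> + 1. real (n_attach (pf_tree \<mu>) (pf_tree \<kappa>)) * g \<kappa>)"
    if lt: "psize \<mu> < ?N" for \<mu>
  proof -
    let ?xs = "part_list \<mu>"
    let ?F = "\<lambda>ys. inj_sum (\<lambda>b i. falling 1 (nth_part \<rho> i) b) ys ?I"
    have "(real ?N - real (psize \<mu>)) * ?F ?xs = ?F (1 # ?xs) + (\<Sum>j<length ?xs. ?F (?xs[j := ?xs ! j + 1]))"
    proof -
      have "(\<Sum>i\<in>?I. falling 1 (nth_part \<rho> i) 1) = real ?N"
        using sum_nth_part[of \<rho>] by (simp add: falling_def flip: of_nat_sum)
      moreover have "(\<Sum>b\<leftarrow>?xs. real b) = real (psize \<mu>)"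
        by (metis sum_list_of_nat sum_list_part_list)
      \<comment> \<open>The product rule applies with \<open>t b = b\<close>, since
        \<open>falling 1 v b * (v - b)\<close> is the next falling factorial.\<close>
      ultimately show ?thesis
        using inj_sum_mult[of ?I "\<lambda>b i. falling 1 (nth_part \<rho> i) b" 1 real ?xs]
        by (simp add: falling_Suc falling_def)
    qed
    then have rec: "(real ?N - real (psize \<mu>)) * falling_count \<mu> \<rho> =
        falling_count (partition_of (1 # ?xs)) \<rho> + (\<Sum>j<length ?xs. falling_count (partition_of (?xs[j := ?xs ! j + 1])) \<rho>)"
      using positive_list_update[of 1 ?xs] by (simp add: falling_count_partition_of falling_count_def[of \<mu>])
    have "(\<Sum>\<kappa> | psize \<kappa> = psize \<mu> + 1. real (n_attach (pf_tree \<mu>) (pf_tree \<kappa>)) * g \<kappa>) =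
        (\<Sum>\<kappa> | psize \<kappa> = psize \<mu> + 1. real (n_attach (pf_tree \<mu>) (pf_tree \<kappa>)) * falling_count \<kappa> \<rho>) *
          fact (?N - psize \<mu> - 1)"
      unfolding sum_distrib_right by (intro sum.cong) (auto simp: g_def)
    also have "\<dots> = ((real ?N - real (psize \<mu>)) * falling_count \<mu> \<rho>) * fact (?N - psize \<mu> - 1)"
      using sum_n_attach[of ?xs "\<lambda>\<kappa>. falling_count \<kappa> \<rho>"] rec by simp
    also have "\<dots> = g \<mu>"
      using lt fact_reduce[of "?N - psize \<mu>", where 'a=real] by (simp add: g_def of_nat_diff)
    finally show ?thesis by simp
  qed
  then have "g \<mu> = (\<Sum>\<nu> | psize \<nu> = ?N. real (n_pf \<mu> \<nu>) * g \<nu>)"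
    by (rule n_pf_expand) (use assms in auto)
  also have "\<dots> = (\<Sum>\<nu> | psize \<nu> = ?N. if \<nu> = \<rho> then real (n_pf \<mu> \<nu>) * falling_count \<rho> \<rho> else 0)"
    by (intro sum.cong) (auto simp: g_def falling_count_eq_0)
  also have "\<dots> = real (n_pf \<mu> \<rho>) * falling_count \<rho> \<rho>" by simp
  finally show ?thesis by (simp add: g_def)
qed

text \<open>\<open>falling_count \<rho> \<rho>\<close> is the product of the factorials of the parts
  and of the multiplicities, so \<open>u_pf\<close> is the number of set partitions of shape
  \<rho>.\<close>

lemma fact_eq_u_pf: "fact (psize \<rho>) = real (u_pf \<rho>) * falling_count \<rho> \<rho>"
  using n_pf_falling_count[of empty_partition \<rho>]
  by (simp add: u_pf_def empty_partition_eq falling_count_partition_of)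

lemma u_pf_neq_0 [simp]: "u_pf \<rho> \<noteq> 0"
  using fact_eq_u_pf[of \<rho>] by (cases "u_pf \<rho>") auto

text \<open>Comparing the counts from \<mu> and from the empty partition cancels
  \<open>falling_count \<rho> \<rho>\<close>; the quotient of the two factorials is a falling
  factorial of the size.\<close>

lemma kernel_formula:
  assumes "psize \<mu> \<le> psize \<rho>"
  shows "real (n_pf \<mu> \<rho>) / real (u_pf \<rho>) * falling 1 (psize \<rho>) (psize \<mu>) = falling_count \<mu> \<rho>"
proof -
  have nz: "falling_count \<rho> \<rho> \<noteq> 0" using fact_eq_u_pf[of \<rho>] by auto
  have f: "falling 1 (psize \<rho>) (psize \<mu>) * fact (psize \<rho> - psize \<mu>) = fact (psize \<rho>)"
    using falling_fact[of "psize \<rho> - psize \<mu>" "psize \<mu>"] assms by simp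
  have "real (n_pf \<mu> \<rho>) / real (u_pf \<rho>) * falling 1 (psize \<rho>) (psize \<mu>) * fact (psize \<rho> - psize \<mu>) =
      real (n_pf \<mu> \<rho>) * falling_count \<rho> \<rho>"
    using f fact_eq_u_pf[of \<rho>] by (simp add: mult.assoc)
  also have "\<dots> = falling_count \<mu> \<rho> * fact (psize \<rho> - psize \<mu>)"
    using n_pf_falling_count[OF assms] by (simp only: mult.commute)
  finally show ?thesis by (simp only: mult_right_cancel[OF fact_nonzero])
qed

definition aug_value :: "(nat \<Rightarrow> real) \<Rightarrow> int_partition \<Rightarrow> real" where
  "aug_value p \<mu> = aug_poly (power_sums p) (part_list \<mu>)"

lemma aug_value_scaled:
  assumes "psize \<rho> > 0"
  shows "aug_value (scaled \<rho>) \<mu> =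
    inj_sum (\<lambda>b i. (real (nth_part \<rho> i) / real (psize \<rho>)) ^ b) (part_list \<mu>) {..<length (part_list \<rho>)}"
  unfolding aug_value_def
  using aug_poly_inj_sum[of "{..<length (part_list \<rho>)}" "power_sums (scaled \<rho>)" "scaled \<rho>" "part_list \<mu>"]
    power_sums_scaled[OF assms]
  by (simp add: scaled_def)

text \<open>With \<mu> of size \<open>m\<close> and \<rho> of size \<open>N\<close>, the
  denominator, scaled by \<open>N ^ m\<close>, differs from 1 by at most
  \<open>m\<^sup>2 / N\<close>. The threshold keeps it above 1/2, so the quotient is at most 2 and
  dividing costs at most \<open>2 * m\<^sup>2 / N\<close>.\<close>

lemma kernel_approx:
  obtains C where "C \<ge> 0" "\<And>\<rho>. psize \<rho> > 2 * (psize \<mu>)\<^sup>2 \<Longrightarrow>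
    \<bar>real (n_pf \<mu> \<rho>) / real (u_pf \<rho>) - aug_value (scaled \<rho>) \<mu>\<bar> \<le> C / real (psize \<rho>)"
proof -
  let ?m = "psize \<mu>" and ?xs = "part_list \<mu>"
  let ?C = "\<Sum>b\<leftarrow>?xs. (real b)\<^sup>2"
  have C: "?C \<ge> 0" by (intro sum_list_nonneg) auto
  have "\<bar>real (n_pf \<mu> \<rho>) / real (u_pf \<rho>) - aug_value (scaled \<rho>) \<mu>\<bar> \<le> (2 * (real ?m)\<^sup>2 + ?C) / real (psize \<rho>)"
    if big: "psize \<rho> > 2 * ?m\<^sup>2" for \<rho>
  proof -
    let ?N = "psize \<rho>" and ?I = "{..<length (part_list \<rho>)}"
    define D where "D = real (n_pf \<mu> \<rho>) / real (u_pf \<rho>)"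
    define R where "R = falling (1 / real ?N) ?N ?m"
    define F where "F = inj_sum (\<lambda>b i. falling (1 / real ?N) (nth_part \<rho> i) b) ?xs ?I"
    have N: "?N > 0" using big by simp
    have mN: "?m \<le> ?N" using big by (metis le_square less_le_trans less_or_eq_imp_le mult_2 power2_eq_square trans_le_add1 le_trans)
    have F: "0 \<le> F" "F \<le> 1" "\<bar>F - aug_value (scaled \<rho>) \<mu>\<bar> \<le> ?C / real ?N"
      using inj_sum_falling_approx[of ?I "nth_part \<rho>" ?N ?xs] N
      by (auto simp: F_def aug_value_scaled sum_nth_part)
    have "F = (1 / real ?N) ^ ?m * falling_count \<mu> \<rho>"
      unfolding F_def falling_count_def
      by (subst inj_sum_scale[OF falling_scale]) simp
    then have DR: "D * R = F"
      using kernel_formula[OF mN] falling_scale[of "1 / real ?N" ?N ?m]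
      by (simp only: D_def R_def) (simp only: mult.left_commute)
    have R: "\<bar>R - 1\<bar> \<le> (real ?m)\<^sup>2 / real ?N"
    proof (cases "?m = 0")
      case False
      then show ?thesis using falling_bounds(3)[of ?N ?N ?m] N by (simp add: R_def)
    qed (simp add: R_def)
    have "(real ?m)\<^sup>2 / real ?N \<le> 1 / 2"
    proof -
      have "2 * (real ?m)\<^sup>2 \<le> real ?N"
        using big by (metis less_imp_le_nat of_nat_le_iff of_nat_mult of_nat_numeral of_nat_power)
      then show ?thesis using N by (simp add: field_simps)
    qed
    then have R2: "R \<ge> 1 / 2" using R by linarith
    have D0: "0 \<le> D" by (simp add: D_def)
    have D2: "D \<le> 2"
    proof -
      have "D * (1 / 2) \<le> D * R" using R2 D0 by (intro mult_left_mono)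
      then show ?thesis using DR F by simp
    qed
    have "D - F = D * (1 - R)" using DR by (simp add: algebra_simps)
    then have "\<bar>D - F\<bar> = D * \<bar>R - 1\<bar>" using D0 by (simp add: abs_mult abs_minus_commute)
    also have "\<dots> \<le> 2 * ((real ?m)\<^sup>2 / real ?N)" using D2 D0 R by (intro mult_mono) auto
    finally have "\<bar>D - aug_value (scaled \<rho>) \<mu>\<bar> \<le> 2 * ((real ?m)\<^sup>2 / real ?N) + ?C / real ?N"
      using F(3) by linarith
    then show ?thesis by (simp add: D_def add_divide_distrib)
  qed
  then show thesis using C by (intro that[of "2 * (real ?m)\<^sup>2 + ?C"]) auto
qed

section \<open>Extremality\<close>

lemma boundary_point_eq:
  assumes "p \<in> nabla_infty"
  shows "boundary_point p \<mu> = real (u_pf \<mu>) * aug_value p \<mu>"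
  using chi_aug_monomial_sym[OF assms, of "part_list \<mu>"]
  by (simp add: boundary_point_def aug_value_def)

lemma boundary_fun_boundary_point:
  "p \<in> nabla_infty \<Longrightarrow> boundary_fun (boundary_point p) = aug_value p"
  by (simp add: boundary_fun_def boundary_point_eq fun_eq_iff)

lemma continuous_on_aug_value: "continuous_on nabla_infty (\<lambda>p. aug_value p \<mu>)"
  unfolding aug_value_def by (rule continuous_on_aug_poly) simp

lemma tendsto_aug_value:
  assumes "p \<in> nabla_infty" "(\<lambda>n. scaled (\<rho> n)) \<longlonglongrightarrow> p"
  shows "(\<lambda>n. aug_value (scaled (\<rho> n)) \<mu>) \<longlonglongrightarrow> aug_value p \<mu>"
  using continuous_on_tendsto_compose[OF continuous_on_aug_value assms(2,1)] scaled_in_nabla by simp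

lemma kernel_minus_aug_value_tendsto_0:
  assumes "filterlim (\<lambda>n. psize (\<rho> n)) at_top sequentially"
  shows "(\<lambda>n. real (n_pf \<mu> (\<rho> n)) / real (u_pf (\<rho> n)) - aug_value (scaled (\<rho> n)) \<mu>) \<longlonglongrightarrow> 0"
proof -
  obtain C where C: "C \<ge> 0" "\<And>\<rho>. psize \<rho> > 2 * (psize \<mu>)\<^sup>2 \<Longrightarrow>
    \<bar>real (n_pf \<mu> \<rho>) / real (u_pf \<rho>) - aug_value (scaled \<rho>) \<mu>\<bar> \<le> C / real (psize \<rho>)"
    using kernel_approx[of \<mu>] by blast
  show ?thesis
  proof (rule Lim_null_comparison)
    show "\<forall>\<^sub>F n in sequentially. norm (real (n_pf \<mu> (\<rho> n)) / real (u_pf (\<rho> n)) - aug_value (scaled (\<rho> n)) \<mu>)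
        \<le> C / real (psize (\<rho> n))"
      using filterlim_at_top[THEN iffD1, OF assms, rule_format, of "Suc (2 * (psize \<mu>)\<^sup>2)"]
      by eventually_elim (simp add: C)
    show "(\<lambda>n. C / real (psize (\<rho> n))) \<longlonglongrightarrow> 0"
      by (intro tendsto_divide_0[OF tendsto_const] filterlim_at_top_imp_at_infinity
          filterlim_compose[OF filterlim_real_sequentially] assms)
  qed
qed

text \<open>Not visible in the polynomial with its signs. At scaled partitions the value is a sum of
  nonnegative terms bounded by 1, and these points are dense.\<close>

lemma aug_value_bounds:
  assumes p: "p \<in> nabla_infty"
  shows "0 \<le> aug_value p \<mu>" "aug_value p \<mu> \<le> 1"
proof -
  obtain \<rho> where \<rho>: "\<And>N. psize (\<rho> N) = N" and lim: "(\<lambda>N. scaled (\<rho> N)) \<longlonglongrightarrow> p"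
    using exists_approximating_partitions[OF p] by blast
  have ev: "\<forall>\<^sub>F N in sequentially. 0 \<le> aug_value (scaled (\<rho> N)) \<mu> \<and> aug_value (scaled (\<rho> N)) \<mu> \<le> 1"
    using eventually_gt_at_top[of 0]
  proof eventually_elim
    case (elim N)
    then show ?case
      using inj_sum_falling_approx[of "{..<length (part_list (\<rho> N))}" "nth_part (\<rho> N)" N "part_list \<mu>"] \<rho>[of N]
      by (simp add: aug_value_scaled sum_nth_part)
  qed
  have L: "(\<lambda>N. aug_value (scaled (\<rho> N)) \<mu>) \<longlonglongrightarrow> aug_value p \<mu>"
    by (rule tendsto_aug_value[OF p lim])
  show "0 \<le> aug_value p \<mu>"
    using L by (rule tendsto_lowerbound) (use ev in \<open>auto elim: eventually_mono\<close>)
  show "aug_value p \<mu> \<le> 1"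
    using L by (rule tendsto_upperbound) (use ev in \<open>auto elim: eventually_mono\<close>)
qed

text \<open>\<open>aug_poly\<close> is not visibly symmetric in the list; two lists of one partition
  agree because both give the value of \<open>chi p\<close> at the same series.\<close>

lemma aug_value_partition_of:
  assumes "p \<in> nabla_infty" "0 \<notin> set xs"
  shows "aug_value p (partition_of xs) = aug_poly (power_sums p) xs"
  using chi_aug_monomial_sym[OF assms] chi_aug_monomial_sym[OF assms(1), of "part_list (partition_of xs)"]
  by (simp add: aug_value_def)

lemma normalized_aug_value: "p \<in> nabla_infty \<Longrightarrow> normalized (aug_value p)"
  by (simp add: normalized_def empty_partition_eq aug_value_partition_of)

text \<open>The recursion for \<open>a = 1\<close>, with the first power sum equal to 1, is
  harmonicity.\<close>

lemma harmonic_aug_value: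
  assumes p: "p \<in> nabla_infty" shows "harmonic (aug_value p)"
  unfolding harmonic_iff
proof (intro conjI allI impI)
  fix xs :: "nat list" assume xs: "0 \<notin> set xs"
  then show "aug_value p (partition_of xs) =
      aug_value p (partition_of (1 # xs)) + (\<Sum>j<length xs. aug_value p (partition_of (xs[j := xs ! j + 1])))"
    using positive_list_update[of 1 xs]
    by (simp add: aug_value_partition_of[OF p] power_sums_def)
qed (rule aug_value_bounds[OF p])

section \<open>Means over a level of the graph\<close>

definition level_mean :: "(int_partition \<Rightarrow> real) \<Rightarrow> nat \<Rightarrow> (int_partition \<Rightarrow> real) \<Rightarrow> real" where
  "level_mean h N f = (\<Sum>\<rho> | psize \<rho> = N. real (u_pf \<rho>) * h \<rho> * f \<rho>)"

lemma harmonic_nonneg: "harmonic h \<Longrightarrow> 0 \<le> h \<mu>"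
  unfolding harmonic_def by blast

text \<open>The weight \<open>u_pf\<close> cancels the denominator, so this mean is exact on every
  level and not only asymptotic.\<close>

lemma harmonic_level_mean:
  assumes "harmonic h" "psize \<mu> \<le> N"
  shows "level_mean h N (\<lambda>\<rho>. real (n_pf \<mu> \<rho>) / real (u_pf \<rho>)) = h \<mu>"
proof -
  have "h \<mu> = (\<Sum>\<rho> | psize \<rho> = N. real (n_pf \<mu> \<rho>) * h \<rho>)"
    by (rule n_pf_expand[OF _ assms(2)]) (use assms(1) in \<open>unfold harmonic_def, blast\<close>)
  also have "\<dots> = level_mean h N (\<lambda>\<rho>. real (n_pf \<mu> \<rho>) / real (u_pf \<rho>))"
    unfolding level_mean_def by (intro sum.cong) auto
  finally show ?thesis by simp
qed

lemma level_mean_cmult: "level_mean h N (\<lambda>\<rho>. c * f \<rho>) = c * level_mean h N f"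
  by (simp add: level_mean_def sum_distrib_left mult_ac)

text \<open>From the empty partition the quotient is 1, so the weights on a level have total mass
  \<open>h empty_partition\<close>.\<close>

lemma level_mean_const:
  assumes "harmonic h" shows "level_mean h N (\<lambda>_. c) = c * h empty_partition"
proof -
  have "level_mean h N (\<lambda>\<rho>. real (n_pf empty_partition \<rho>) / real (u_pf \<rho>)) = h empty_partition"
    using assms by (intro harmonic_level_mean) (simp_all add: empty_partition_eq)
  then have "level_mean h N (\<lambda>_. 1) = h empty_partition" by (simp add: u_pf_def[symmetric])
  then show ?thesis using level_mean_cmult[of h N c "\<lambda>_. 1"] by simp
qed

lemma level_mean_mono:
  assumes "harmonic h" "\<And>\<rho>. psize \<rho> = N \<Longrightarrow> f \<rho> \<le> g \<rho>"
  shows "level_mean h N f \<le> level_mean h N g"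
  unfolding level_mean_def using assms harmonic_nonneg[OF assms(1)] by (intro sum_mono mult_left_mono) auto

lemma level_mean_add: "level_mean h N (\<lambda>\<rho>. f \<rho> + g \<rho>) = level_mean h N f + level_mean h N g"
  by (simp add: level_mean_def distrib_left sum.distrib)

lemma level_mean_diff: "level_mean h N (\<lambda>\<rho>. f \<rho> - g \<rho>) = level_mean h N f - level_mean h N g"
  by (simp add: level_mean_def right_diff_distrib sum_subtractf)

lemma level_mean_nonneg:
  "harmonic h \<Longrightarrow> (\<And>\<rho>. 0 \<le> f \<rho>) \<Longrightarrow> 0 \<le> level_mean h N f"
  unfolding level_mean_def by (intro sum_nonneg mult_nonneg_nonneg) (auto simp: harmonic_nonneg)

lemma level_mean_abs: "harmonic h \<Longrightarrow> \<bar>level_mean h N f\<bar> \<le> level_mean h N (\<lambda>\<rho>. \<bar>f \<rho>\<bar>)"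
  unfolding level_mean_def
  by (rule order_trans[OF sum_abs]) (auto simp: abs_mult harmonic_nonneg intro!: sum_mono)

section \<open>Concentration under the law of a boundary point, and minimality\<close>

context
  fixes p h
  assumes p: "p \<in> nabla_infty" and h: "h = aug_value p"
begin

lemma h_harmonic: "harmonic h" and h_empty: "h empty_partition = 1"
  using harmonic_aug_value[OF p] normalized_aug_value[OF p] by (auto simp: h normalized_def)

lemma level_mean_kernel_approx:
  "(\<lambda>N. level_mean h N (\<lambda>\<rho>. \<bar>real (n_pf \<mu> \<rho>) / real (u_pf \<rho>) - aug_value (scaled \<rho>) \<mu>\<bar>)) \<longlonglongrightarrow> 0"
proof -
  obtain C where C: "C \<ge> 0" "\<And>\<rho>. psize \<rho> > 2 * (psize \<mu>)\<^sup>2 \<Longrightarrow>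
    \<bar>real (n_pf \<mu> \<rho>) / real (u_pf \<rho>) - aug_value (scaled \<rho>) \<mu>\<bar> \<le> C / real (psize \<rho>)"
    using kernel_approx[of \<mu>] by blast
  show ?thesis
  proof (rule Lim_null_comparison)
    show "\<forall>\<^sub>F N in sequentially. norm (level_mean h N (\<lambda>\<rho>. \<bar>real (n_pf \<mu> \<rho>) / real (u_pf \<rho>) - aug_value (scaled \<rho>) \<mu>\<bar>))
       \<le> C * inverse (real N)"
      using eventually_gt_at_top[of "2 * (psize \<mu>)\<^sup>2"]
    proof eventually_elim
      case (elim N)
      have "level_mean h N (\<lambda>\<rho>. \<bar>real (n_pf \<mu> \<rho>) / real (u_pf \<rho>) - aug_value (scaled \<rho>) \<mu>\<bar>) \<le> level_mean h N (\<lambda>_. C * inverse (real N))"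
        using C(2) elim by (intro level_mean_mono h_harmonic) (auto simp: divide_inverse)
      also have "\<dots> = C * inverse (real N)" by (simp add: level_mean_const[OF h_harmonic] h_empty)
      finally show ?case using level_mean_nonneg[OF h_harmonic, of "\<lambda>\<rho>. \<bar>_ \<rho>\<bar>"] by simp
    qed
    show "(\<lambda>N. C * inverse (real N)) \<longlonglongrightarrow> 0"
      by (rule tendsto_mult_right_zero[OF lim_inverse_n])
  qed
qed

text \<open>The mean of the kernel is eventually constant, and the augmented monomial differs from
  the kernel by a quantity that vanishes in mean.\<close>

lemma level_mean_aug_value: "(\<lambda>N. level_mean h N (\<lambda>\<rho>. aug_value (scaled \<rho>) \<mu>)) \<longlonglongrightarrow> h \<mu>"
proof -
  let ?D = "\<lambda>\<rho>. real (n_pf \<mu> \<rho>) / real (u_pf \<rho>)"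
  have "(\<lambda>N. level_mean h N (\<lambda>\<rho>. ?D \<rho> - aug_value (scaled \<rho>) \<mu>)) \<longlonglongrightarrow> 0"
    using level_mean_kernel_approx[of \<mu>] by (rule Lim_null_comparison[rotated]) (simp add: level_mean_abs[OF h_harmonic])
  then have "(\<lambda>N. level_mean h N ?D - level_mean h N (\<lambda>\<rho>. ?D \<rho> - aug_value (scaled \<rho>) \<mu>)) \<longlonglongrightarrow> h \<mu> - 0"
  proof (rule tendsto_diff[rotated])
    have "\<forall>\<^sub>F N in sequentially. level_mean h N ?D = h \<mu>"
      using eventually_ge_at_top[of "psize \<mu>"] by eventually_elim (rule harmonic_level_mean[OF h_harmonic])
    then show "(\<lambda>N. level_mean h N ?D) \<longlonglongrightarrow> h \<mu>" by (rule tendsto_eventually)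
  qed
  then show ?thesis by (simp add: level_mean_diff)
qed

text \<open>The second moment: \<open>p\<^sub>k\<^sup>2\<close> is the sum of the augmented monomials of \<open>(k, k)\<close> and \<open>(2k)\<close>.\<close>

lemma level_mean_power_sums:
  assumes k: "k > 0"
  shows "(\<lambda>N. level_mean h N (\<lambda>\<rho>. \<bar>power_sums (scaled \<rho>) k - power_sums p k\<bar>)) \<longlonglongrightarrow> 0"
proof -
  let ?q = "\<lambda>\<rho>. power_sums (scaled \<rho>) k" and ?c = "power_sums p k"
  have q: "power_sums x k = aug_value x (partition_of [k])" and
    q2: "(power_sums x k)\<^sup>2 = aug_value x (partition_of [k, k]) + aug_value x (partition_of [k + k])"
    if "x \<in> nabla_infty" for x
    using k by (simp_all add: aug_value_partition_of[OF that] power2_eq_square)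
  have 1: "(\<lambda>N. level_mean h N ?q) \<longlonglongrightarrow> ?c"
    using level_mean_aug_value[of "partition_of [k]"] by (simp add: q scaled_in_nabla p h)
  have 2: "(\<lambda>N. level_mean h N (\<lambda>\<rho>. (?q \<rho>)\<^sup>2)) \<longlonglongrightarrow> ?c\<^sup>2"
    using tendsto_add[OF level_mean_aug_value[of "partition_of [k, k]"] level_mean_aug_value[of "partition_of [k + k]"]]
    unfolding q2[OF p] q2[OF scaled_in_nabla] h[symmetric] by (simp only: level_mean_add)
  have "(?q \<rho> - ?c)\<^sup>2 = ((?q \<rho>)\<^sup>2 - 2 * ?c * ?q \<rho>) + ?c\<^sup>2" for \<rho>
    by (simp add: power2_eq_square algebra_simps)
  then have "level_mean h N (\<lambda>\<rho>. (?q \<rho> - ?c)\<^sup>2) = level_mean h N (\<lambda>\<rho>. (?q \<rho>)\<^sup>2) - 2 * ?c * level_mean h N ?q + ?c\<^sup>2" for N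
    by (simp only: level_mean_add level_mean_diff level_mean_cmult level_mean_const[OF h_harmonic] h_empty mult_1_right)
  then have "(\<lambda>N. level_mean h N (\<lambda>\<rho>. (?q \<rho> - ?c)\<^sup>2)) \<longlonglongrightarrow> ?c\<^sup>2 - 2 * ?c * ?c + ?c\<^sup>2"
    by (simp only:) (intro tendsto_intros 1 2)
  then have var: "(\<lambda>N. level_mean h N (\<lambda>\<rho>. (?q \<rho> - ?c)\<^sup>2)) \<longlonglongrightarrow> 0"
    by (simp add: power2_eq_square)
  \<comment> \<open>The weights have mass 1, so the variance of the distance about its own mean is
    nonnegative; expanding it gives the inequality.\<close>
  have jensen: "(level_mean h N (\<lambda>\<rho>. \<bar>?q \<rho> - ?c\<bar>))\<^sup>2 \<le> level_mean h N (\<lambda>\<rho>. (?q \<rho> - ?c)\<^sup>2)" for N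
  proof -
    let ?f = "\<lambda>\<rho>. \<bar>?q \<rho> - ?c\<bar>" and ?M = "level_mean h N (\<lambda>\<rho>. \<bar>?q \<rho> - ?c\<bar>)"
    have e: "(?f \<rho> - ?M)\<^sup>2 = ((?q \<rho> - ?c)\<^sup>2 - 2 * ?M * ?f \<rho>) + ?M\<^sup>2" for \<rho>
      by (simp add: power2_diff mult_ac)
    have "0 \<le> level_mean h N (\<lambda>\<rho>. (?f \<rho> - ?M)\<^sup>2)" by (rule level_mean_nonneg[OF h_harmonic]) simp
    also have "\<dots> = level_mean h N (\<lambda>\<rho>. (?q \<rho> - ?c)\<^sup>2) - 2 * ?M * ?M + ?M\<^sup>2"
      unfolding e level_mean_add level_mean_diff level_mean_cmult level_mean_const[OF h_harmonic] h_empty by simp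
    finally show ?thesis by (simp add: power2_eq_square)
  qed
  have "(\<lambda>N. (level_mean h N (\<lambda>\<rho>. \<bar>?q \<rho> - ?c\<bar>))\<^sup>2) \<longlonglongrightarrow> 0"
    using var by (rule Lim_null_comparison[rotated]) (simp add: jensen)
  then have "(\<lambda>N. sqrt ((level_mean h N (\<lambda>\<rho>. \<bar>?q \<rho> - ?c\<bar>))\<^sup>2)) \<longlonglongrightarrow> sqrt 0"
    by (rule tendsto_real_sqrt)
  then show ?thesis by (simp add: tendsto_rabs_zero_iff)
qed

text \<open>Convergence in mean passes along the recursion, because products of factors in [0, 1]
  respect it.\<close>

lemma level_mean_aug_poly:
  "0 \<notin> set xs \<Longrightarrow>
    (\<lambda>N. level_mean h N (\<lambda>\<rho>. \<bar>aug_poly (power_sums (scaled \<rho>)) xs - aug_poly (power_sums p) xs\<bar>)) \<longlonglongrightarrow> 0"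
proof (induction xs rule: length_induct)
  case (1 xs)
  show ?case
  proof (cases xs)
    case Nil
    then show ?thesis by (simp add: level_mean_const[OF h_harmonic])
  next
    case (Cons a ys)
    then have a: "a > 0" "0 \<notin> set ys" using 1 by auto
    let ?A = "\<lambda>xs \<rho>. aug_poly (power_sums (scaled \<rho>)) xs" and ?B = "\<lambda>xs. aug_poly (power_sums p) xs"
    let ?q = "\<lambda>\<rho>. power_sums (scaled \<rho>) a" and ?c = "power_sums p a"
    let ?ys = "\<lambda>j. ys[j := ys ! j + a]"
    have shrink: "\<bar>x * y\<bar> \<le> \<bar>x\<bar>" if "0 \<le> y" "y \<le> 1" for x y :: real
      using that by (simp add: abs_mult mult_left_le)
    have le: "\<bar>?A xs \<rho> - ?B xs\<bar> \<le> \<bar>?q \<rho> - ?c\<bar> + \<bar>?A ys \<rho> - ?B ys\<bar> + (\<Sum>j<length ys. \<bar>?A (?ys j) \<rho> - ?B (?ys j)\<bar>)" for \<rho>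
    proof -
      have "?A xs \<rho> - ?B xs = (?q \<rho> - ?c) * ?A ys \<rho> + ?c * (?A ys \<rho> - ?B ys) - (\<Sum>j<length ys. ?A (?ys j) \<rho> - ?B (?ys j))"
        by (simp add: Cons sum_subtractf algebra_simps)
      then have "\<bar>?A xs \<rho> - ?B xs\<bar> \<le> \<bar>(?q \<rho> - ?c) * ?A ys \<rho>\<bar> + \<bar>?c * (?A ys \<rho> - ?B ys)\<bar> + \<bar>\<Sum>j<length ys. ?A (?ys j) \<rho> - ?B (?ys j)\<bar>"
        by linarith
      moreover have "\<bar>(?q \<rho> - ?c) * ?A ys \<rho>\<bar> \<le> \<bar>?q \<rho> - ?c\<bar>"
        using aug_value_bounds[OF scaled_in_nabla, of \<rho> "partition_of ys"]
        unfolding aug_value_partition_of[OF scaled_in_nabla a(2)] by (rule shrink)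
      moreover have "\<bar>?c * (?A ys \<rho> - ?B ys)\<bar> \<le> \<bar>?A ys \<rho> - ?B ys\<bar>"
        unfolding mult.commute[of ?c]
        by (rule shrink[OF power_sums_nonneg[OF p a(1)] power_sums_le_1[OF p a(1)]])
      moreover have "\<bar>\<Sum>j<length ys. ?A (?ys j) \<rho> - ?B (?ys j)\<bar> \<le> (\<Sum>j<length ys. \<bar>?A (?ys j) \<rho> - ?B (?ys j)\<bar>)"
        by (rule sum_abs)
      ultimately show ?thesis by linarith
    qed
    have sum: "level_mean h N (\<lambda>\<rho>. \<Sum>j<length ys. \<bar>?A (?ys j) \<rho> - ?B (?ys j)\<bar>) =
        (\<Sum>j<length ys. level_mean h N (\<lambda>\<rho>. \<bar>?A (?ys j) \<rho> - ?B (?ys j)\<bar>))" for N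
      by (simp add: level_mean_def sum_distrib_left sum.swap[of _ "{..<length ys}"])
    have "(\<lambda>N. level_mean h N (\<lambda>\<rho>. \<bar>?q \<rho> - ?c\<bar>) + level_mean h N (\<lambda>\<rho>. \<bar>?A ys \<rho> - ?B ys\<bar>) +
        (\<Sum>j<length ys. level_mean h N (\<lambda>\<rho>. \<bar>?A (?ys j) \<rho> - ?B (?ys j)\<bar>))) \<longlonglongrightarrow> 0 + 0 + (\<Sum>j<length ys. 0)"
      using 1 Cons a positive_list_update[OF a]
      by (intro tendsto_add tendsto_sum level_mean_power_sums) auto
    then have "(\<lambda>N. level_mean h N (\<lambda>\<rho>. \<bar>?q \<rho> - ?c\<bar> + \<bar>?A ys \<rho> - ?B ys\<bar> + (\<Sum>j<length ys. \<bar>?A (?ys j) \<rho> - ?B (?ys j)\<bar>))) \<longlonglongrightarrow> 0"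
      by (simp only: level_mean_add sum) simp
    then show ?thesis
    proof (rule Lim_null_comparison[rotated], intro always_eventually allI)
      fix N
      show "norm (level_mean h N (\<lambda>\<rho>. \<bar>?A xs \<rho> - ?B xs\<bar>)) \<le>
        level_mean h N (\<lambda>\<rho>. \<bar>?q \<rho> - ?c\<bar> + \<bar>?A ys \<rho> - ?B ys\<bar> + (\<Sum>j<length ys. \<bar>?A (?ys j) \<rho> - ?B (?ys j)\<bar>))"
        using level_mean_mono[OF h_harmonic le, of N] level_mean_nonneg[OF h_harmonic, of "\<lambda>\<rho>. \<bar>?A xs \<rho> - ?B xs\<bar>" N]
        by simp
    qed
  qed
qed

lemma level_mean_kernel: "(\<lambda>N. level_mean h N (\<lambda>\<rho>. \<bar>real (n_pf \<mu> \<rho>) / real (u_pf \<rho>) - h \<mu>\<bar>)) \<longlonglongrightarrow> 0"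
proof -
  let ?D = "\<lambda>\<rho>. real (n_pf \<mu> \<rho>) / real (u_pf \<rho>)" and ?A = "\<lambda>\<rho>. aug_value (scaled \<rho>) \<mu>"
  have "(\<lambda>N. level_mean h N (\<lambda>\<rho>. \<bar>?D \<rho> - ?A \<rho>\<bar> + \<bar>?A \<rho> - h \<mu>\<bar>)) \<longlonglongrightarrow> 0 + 0"
    unfolding level_mean_add
    using level_mean_aug_poly[of "part_list \<mu>"]
    by (intro tendsto_add level_mean_kernel_approx) (simp add: aug_value_def h)
  then have lim: "(\<lambda>N. level_mean h N (\<lambda>\<rho>. \<bar>?D \<rho> - ?A \<rho>\<bar> + \<bar>?A \<rho> - h \<mu>\<bar>)) \<longlonglongrightarrow> 0" by simp
  show ?thesis
  proof (rule Lim_null_comparison[OF always_eventually lim], rule allI)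
    fix N
    have "level_mean h N (\<lambda>\<rho>. \<bar>?D \<rho> - h \<mu>\<bar>) \<le> level_mean h N (\<lambda>\<rho>. \<bar>?D \<rho> - ?A \<rho>\<bar> + \<bar>?A \<rho> - h \<mu>\<bar>)"
      by (rule level_mean_mono[OF h_harmonic]) linarith
    then show "norm (level_mean h N (\<lambda>\<rho>. \<bar>?D \<rho> - h \<mu>\<bar>)) \<le> level_mean h N (\<lambda>\<rho>. \<bar>?D \<rho> - ?A \<rho>\<bar> + \<bar>?A \<rho> - h \<mu>\<bar>)"
      using level_mean_nonneg[OF h_harmonic, of "\<lambda>\<rho>. \<bar>?D \<rho> - h \<mu>\<bar>" N] by simp
  qed
qed

text \<open>The difference is the mean under \<open>g\<close> of the kernel minus the constant
  \<open>h \<mu>\<close>. Since \<open>g \<le> h\<close>, it is bounded by the mean deviation under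
  \<open>h\<close>, which tends to 0.\<close>

lemma dominated_harmonic_proportional:
  assumes g: "harmonic g" "\<And>\<mu>. g \<mu> \<le> h \<mu>"
  shows "g \<mu> = g empty_partition * h \<mu>"
proof -
  let ?D = "\<lambda>\<rho>. real (n_pf \<mu> \<rho>) / real (u_pf \<rho>)"
  have "\<bar>g \<mu> - g empty_partition * h \<mu>\<bar> \<le> level_mean h N (\<lambda>\<rho>. \<bar>?D \<rho> - h \<mu>\<bar>)" if "N \<ge> psize \<mu>" for N
  proof -
    have "g \<mu> - g empty_partition * h \<mu> = level_mean g N (\<lambda>\<rho>. ?D \<rho> - h \<mu>)"
      using level_mean_const[OF g(1), of N "h \<mu>"] by (simp add: level_mean_diff harmonic_level_mean[OF g(1) that])
    then have "\<bar>g \<mu> - g empty_partition * h \<mu>\<bar> \<le> level_mean g N (\<lambda>\<rho>. \<bar>?D \<rho> - h \<mu>\<bar>)"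
      using level_mean_abs[OF g(1)] by simp
    also have "\<dots> \<le> level_mean h N (\<lambda>\<rho>. \<bar>?D \<rho> - h \<mu>\<bar>)"
      unfolding level_mean_def using g by (intro sum_mono mult_right_mono mult_left_mono) auto
    finally show ?thesis .
  qed
  then have "\<bar>g \<mu> - g empty_partition * h \<mu>\<bar> \<le> 0"
    by (intro tendsto_lowerbound[OF level_mean_kernel[of \<mu>]])
      (auto simp: eventually_sequentially)
  then show ?thesis by simp
qed

lemma spans_minimal_ray_h: "spans_minimal_ray h"
  unfolding spans_minimal_ray_def
proof (intro conjI allI impI)
  show "\<exists>\<mu>. h \<mu> \<noteq> 0" using h_empty by (intro exI[of _ empty_partition]) simp
  fix g assume "harmonic g \<and> (\<forall>\<mu>. g \<mu> \<le> h \<mu>)"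
  then show "\<exists>c. \<forall>\<mu>. g \<mu> = c * h \<mu>" using dominated_harmonic_proportional[of g] by blast
qed (rule h_harmonic)

end

section \<open>The Martin boundary\<close>

text \<open>A countable index set makes the product topology first countable, so closures can be
  described by sequences.\<close>

instance int_partition :: countable
  by (rule countable_classI[of "\<lambda>\<rho>. to_nat (part_list \<rho>)"]) (auto intro!: injI, metis partition_of_part_list)

lemma tendsto_fun_iff:
  fixes f :: "'c \<Rightarrow> 'a \<Rightarrow> 'b::topological_space"
  shows "(f \<longlongrightarrow> l) F \<longleftrightarrow> (\<forall>i. ((\<lambda>c. f c i) \<longlongrightarrow> l i) F)"
  using limitin_componentwise[of "\<lambda>_. euclidean" UNIV f l F]
  by (simp add: euclidean_product_topology)

lemma martin_embed_minus_boundary_point_tendsto_0: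
  assumes "filterlim (\<lambda>n. psize (\<rho> n)) at_top sequentially"
  shows "(\<lambda>n. martin_embed (\<rho> n) \<mu> - boundary_point (scaled (\<rho> n)) \<mu>) \<longlonglongrightarrow> 0"
  using tendsto_mult[OF tendsto_const kernel_minus_aug_value_tendsto_0[OF assms, of \<mu>], of "real (u_pf \<mu>)"]
  by (simp add: martin_embed_def martin_kernel_def boundary_point_eq scaled_in_nabla right_diff_distrib)

lemma continuous_on_boundary_point: "continuous_on nabla_infty boundary_point"
proof (rule continuous_on_coordinatewise_then_product)
  fix \<mu>
  have "continuous_on nabla_infty (\<lambda>p. real (u_pf \<mu>) * aug_value p \<mu>)"
    by (intro continuous_intros continuous_on_aug_value)
  then show "continuous_on nabla_infty (\<lambda>p. boundary_point p \<mu>)"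
    by (rule continuous_on_eq) (simp add: boundary_point_eq)
qed

text \<open>The coordinates at one-part partitions determine the power sums.\<close>

lemma inj_on_boundary_point: "inj_on boundary_point nabla_infty"
proof (rule inj_onI)
  fix p p' assume p: "p \<in> nabla_infty" "p' \<in> nabla_infty" and eq: "boundary_point p = boundary_point p'"
  have "power_sums p k = power_sums p' k" if "k \<ge> 2" for k
    using fun_cong[OF eq, of "partition_of [k]"] p that
    by (simp add: boundary_point_eq aug_value_partition_of)
  then show "p = p'" using p by (intro power_sums_inject) auto
qed

lemma martin_embed_tendsto:
  assumes p: "p \<in> nabla_infty" and N: "filterlim (\<lambda>n. psize (\<rho> n)) at_top sequentially"
    and "(\<lambda>n. scaled (\<rho> n)) \<longlonglongrightarrow> p"
  shows "(\<lambda>n. martin_embed (\<rho> n)) \<longlonglongrightarrow> boundary_point p"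
  unfolding tendsto_fun_iff
proof
  fix \<mu>
  have "(\<lambda>n. boundary_point (scaled (\<rho> n)) \<mu>) \<longlonglongrightarrow> boundary_point p \<mu>"
    using continuous_on_tendsto_compose[OF continuous_on_boundary_point assms(3,1)] scaled_in_nabla
    by (simp add: tendsto_fun_iff)
  from tendsto_add[OF martin_embed_minus_boundary_point_tendsto_0[OF N, of \<mu>] this]
  show "(\<lambda>n. martin_embed (\<rho> n) \<mu>) \<longlonglongrightarrow> boundary_point p \<mu>" by simp
qed

lemma boundary_point_in_compactification:
  assumes p: "p \<in> nabla_infty" shows "boundary_point p \<in> martin_compactification"
proof -
  obtain \<rho> where \<rho>: "\<And>N. psize (\<rho> N) = N" and lim: "(\<lambda>N. scaled (\<rho> N)) \<longlonglongrightarrow> p"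
    using exists_approximating_partitions[OF p] by blast
  have "(\<lambda>N. martin_embed (\<rho> N)) \<longlonglongrightarrow> boundary_point p"
    by (rule martin_embed_tendsto[OF p _ lim]) (simp add: \<rho> filterlim_ident)
  then show ?thesis
    unfolding martin_compactification_def
    by (intro closure_sequential[THEN iffD2] exI[of _ "\<lambda>N. martin_embed (\<rho> N)"]) simp
qed

text \<open>The coordinates of an embedded vertex vanish above its level, whereas the law of
  \<open>p\<close> has mass 1 on every level.\<close>

lemma boundary_point_not_embedded:
  assumes p: "p \<in> nabla_infty" shows "boundary_point p \<notin> range martin_embed"
proof
  assume "boundary_point p \<in> range martin_embed"
  then obtain \<rho> where \<rho>: "boundary_point p = martin_embed \<rho>" by blast
  let ?N = "Suc (psize \<rho>)"
  have "aug_value p \<mu> = 0" if "psize \<mu> = ?N" for \<mu>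
  proof -
    have "n_pf \<mu> \<rho> = 0"
    proof -
      have "{es. pf_path \<mu> es \<rho>} = {}" using that by (auto dest: pf_path_psize)
      then show ?thesis by (simp add: n_pf_def)
    qed
    then have "boundary_point p \<mu> = 0" by (simp add: \<rho> martin_embed_def martin_kernel_def)
    then show ?thesis by (simp add: boundary_point_eq[OF p])
  qed
  then have "level_mean (aug_value p) ?N (\<lambda>_. 1) = 0" by (simp add: level_mean_def)
  moreover have "level_mean (aug_value p) ?N (\<lambda>_. 1) = 1"
    using level_mean_const[OF harmonic_aug_value[OF p], of ?N 1] normalized_aug_value[OF p]
    by (simp add: normalized_def)
  ultimately show False by simp
qed

lemma boundary_subset:
  assumes z: "z \<in> martin_boundary" shows "z \<in> boundary_point ` nabla_infty"
proof -
  have "z \<in> closure (range martin_embed)"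
    using z by (simp add: martin_boundary_def martin_compactification_def)
  then obtain x where x: "\<And>n. x n \<in> range martin_embed" "x \<longlonglongrightarrow> z"
    unfolding closure_sequential by blast
  define \<rho> where "\<rho> n = inv martin_embed (x n)" for n
  have "x = (\<lambda>n. martin_embed (\<rho> n))"
    using x(1) by (simp add: \<rho>_def f_inv_into_f fun_eq_iff)
  with x(2) have lim: "(\<lambda>n. martin_embed (\<rho> n)) \<longlonglongrightarrow> z" by simp
  \<comment> \<open>Otherwise infinitely many terms lie in a finite set of partitions, one of these
    recurs, and the limit would be an embedded vertex.\<close>
  have N: "filterlim (\<lambda>n. psize (\<rho> n)) at_top sequentially"
    unfolding filterlim_at_top
  proof (rule allI, rule ccontr)
    fix K assume "\<not> (\<forall>\<^sub>F n in sequentially. K \<le> psize (\<rho> n))"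
    then have "\<exists>\<^sub>F n in sequentially. \<rho> n \<in> {\<mu>. psize \<mu> \<le> K}"
      unfolding not_eventually by (rule frequently_elim1) auto
    then have inf: "infinite {n. \<rho> n \<in> {\<mu>. psize \<mu> \<le> K}}"
      by (simp add: frequently_cofinite[symmetric] cofinite_eq_sequentially)
    have "finite (\<rho> ` {n. \<rho> n \<in> {\<mu>. psize \<mu> \<le> K}})"
      by (rule finite_subset[OF _ finite_psize_le[of K]]) auto
    then obtain n0 where inf': "infinite {n \<in> {n. \<rho> n \<in> {\<mu>. psize \<mu> \<le> K}}. \<rho> n = \<rho> n0}"
      using pigeonhole_infinite[OF inf] by blast
    obtain r :: "nat \<Rightarrow> nat" where r: "strict_mono r" "\<And>n. r n \<in> {n \<in> {n. \<rho> n \<in> {\<mu>. psize \<mu> \<le> K}}. \<rho> n = \<rho> n0}"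
      using infinite_enumerate[OF inf'] by blast
    have "(\<lambda>n. martin_embed (\<rho> (r n))) \<longlonglongrightarrow> z"
      using LIMSEQ_subseq_LIMSEQ[OF lim r(1)] by (simp add: comp_def)
    moreover have "\<rho> (r n) = \<rho> n0" for n using r(2) by blast
    ultimately have "z = martin_embed (\<rho> n0)" by (simp add: LIMSEQ_const_iff)
    then show False using z by (simp add: martin_boundary_def)
  qed
  \<comment> \<open>Along a subsequence the scaled partitions converge in the simplex, and
    uniqueness of limits identifies \<open>z\<close>.\<close>
  have "seq_compact nabla_infty" using compact_nabla by (rule compact_imp_seq_compact)
  then obtain p r where p: "p \<in> nabla_infty" and r: "strict_mono (r :: nat \<Rightarrow> nat)" and
    "((\<lambda>n. scaled (\<rho> n)) \<circ> r) \<longlonglongrightarrow> p"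
    unfolding seq_compact_def using scaled_in_nabla by metis
  then have "(\<lambda>n. martin_embed (\<rho> (r n))) \<longlonglongrightarrow> boundary_point p"
    using filterlim_compose[OF N filterlim_subseq[OF r]] by (intro martin_embed_tendsto) (auto simp: comp_def)
  moreover have "(\<lambda>n. martin_embed (\<rho> (r n))) \<longlonglongrightarrow> z"
    using LIMSEQ_subseq_LIMSEQ[OF lim r] by (simp add: comp_def)
  ultimately have "z = boundary_point p" by (rule LIMSEQ_unique[symmetric])
  then show ?thesis using p by blast
qed

lemma martin_boundary_eq: "martin_boundary = boundary_point ` nabla_infty"
  using boundary_subset boundary_point_in_compactification boundary_point_not_embedded
  by (auto simp: martin_boundary_def)

lemma minimal_martin_boundary_eq: "minimal_martin_boundary = martin_boundary"
  unfolding minimal_martin_boundary_def martin_boundary_eq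
  by (auto simp: boundary_fun_boundary_point normalized_aug_value harmonic_aug_value spans_minimal_ray_h)

text \<open>An embedded vertex and the boundary point of its scaled partition are asymptotically
  equal, so convergence can be tested inside the boundary and pulled back by the continuous inverse
  \<open>g\<close>.\<close>

lemma martin_convergence_iff:
  assumes p: "p \<in> nabla_infty" and N: "filterlim (\<lambda>n. psize (\<rho> n)) at_top sequentially"
    and g: "homeomorphism nabla_infty martin_boundary boundary_point g"
  shows "(\<lambda>n. martin_embed (\<rho> n)) \<longlonglongrightarrow> boundary_point p \<longleftrightarrow> (\<lambda>n. scaled (\<rho> n)) \<longlonglongrightarrow> p"
proof
  assume lim: "(\<lambda>n. martin_embed (\<rho> n)) \<longlonglongrightarrow> boundary_point p"
  have "(\<lambda>n. boundary_point (scaled (\<rho> n)) \<mu>) \<longlonglongrightarrow> boundary_point p \<mu>" for \<mu>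
    using tendsto_diff[OF lim[unfolded tendsto_fun_iff, rule_format, of \<mu>]
        martin_embed_minus_boundary_point_tendsto_0[OF N, of \<mu>]] by simp
  then have lim': "(\<lambda>n. boundary_point (scaled (\<rho> n))) \<longlonglongrightarrow> boundary_point p"
    by (simp add: tendsto_fun_iff)
  have "(\<lambda>n. g (boundary_point (scaled (\<rho> n)))) \<longlonglongrightarrow> g (boundary_point p)"
    using g p scaled_in_nabla
    by (intro continuous_on_tendsto_compose[OF homeomorphism_cont2[OF g] lim'])
      (auto simp: martin_boundary_eq)
  then show "(\<lambda>n. scaled (\<rho> n)) \<longlonglongrightarrow> p"
    using homeomorphism_apply1[OF g] p scaled_in_nabla by simp
qed (rule martin_embed_tendsto[OF p N])

theorem theorem5p4:
  "martin_boundary = minimal_martin_boundary \<and>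
   (\<exists>g. homeomorphism nabla_infty martin_boundary boundary_point g) \<and>
   (\<forall>(N :: nat \<Rightarrow> nat) (\<rho> :: nat \<Rightarrow> int_partition). \<forall>p\<in>nabla_infty.
      filterlim N at_top sequentially \<longrightarrow> (\<forall>j. psize (\<rho> j) = N j) \<longrightarrow>
      (((\<lambda>j. martin_embed (\<rho> j)) \<longlonglongrightarrow> boundary_point p) \<longleftrightarrow>
       (\<forall>i. (\<lambda>j. real (nth_part (\<rho> j) i) / real (N j)) \<longlonglongrightarrow> p i)))"
proof -
  \<comment> \<open>A continuous injection of a compact space into a Hausdorff space is a
    homeomorphism onto its image.\<close>
  obtain g where g: "homeomorphism nabla_infty martin_boundary boundary_point g"
    using homeomorphism_compact[OF compact_nabla continuous_on_boundary_point
        martin_boundary_eq[symmetric] inj_on_boundary_point] by blast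
  have "((\<lambda>j. martin_embed (\<rho> j)) \<longlonglongrightarrow> boundary_point p) \<longleftrightarrow>
      (\<forall>i. (\<lambda>j. real (nth_part (\<rho> j) i) / real (N j)) \<longlonglongrightarrow> p i)"
    if "p \<in> nabla_infty" "filterlim N at_top sequentially" "\<And>j. psize (\<rho> j) = N j" for N \<rho> p
  proof -
    have "((\<lambda>j. martin_embed (\<rho> j)) \<longlonglongrightarrow> boundary_point p) \<longleftrightarrow> (\<lambda>j. scaled (\<rho> j)) \<longlonglongrightarrow> p"
      using that by (intro martin_convergence_iff[OF _ _ g]) auto
    then show ?thesis by (simp add: tendsto_fun_iff scaled_def that(3))
  qed
  with g show ?thesis by (auto simp: minimal_martin_boundary_eq)
qed

end
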